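(* Let $d\ge3$. For every $\varepsilon>0$ there is a finite family $\{S_i\}_{i\in\mathcal I}$ of contracting similarities of $\mathbb{R}^d$ whose attractor $F_\emptyset$ consists of a single point, but such that for every singleton $C\subset\mathbb{R}^d$ with $C\ne F_\emptyset$, the inhomogeneous attractor $F_C$ satisfies $\underline{\dim}_{\mathrm B}F_C\ge d-1-\varepsilon$.
   Context: Given contracting similarities $\{S_i\}_{i\in\mathcal I}$ of $\mathbb{R}^d$ ($\mathcal I$ finite) and a compact set $C\subseteq\mathbb{R}^d$, the inhomogeneous attractor $F_C$ is the unique non-empty compact set with $F_C=\bigcup_{i\in\mathcal I}S_i(F_C)\cup C$; the attractor $F_\emptyset$ is the unique non-empty compact set with $F_\emptyset=\bigcup_i S_i(F_\emptyset)$. The lower box dimension is $\underline{\dim}_{\mathrm B}E=\liminf_{\delta\to0}\log N_\delta(E)/(-\log\delta)$, where $N_\delta(E)$ is the number of half-open $\delta$-mesh cubes meeting $E$. *)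

theory Defs
  imports "HOL-Analysis.Analysis" "HOL-Library.Extended_Real"
begin

definition contracting_similarity :: "('a::metric_space \<Rightarrow> 'a) \<Rightarrow> bool" where
  "contracting_similarity S \<longleftrightarrow>
     (\<exists>r. 0 < r \<and> r < 1 \<and> (\<forall>x y. dist (S x) (S y) = r * dist x y))"

definition inhom_attractor :: "'i set \<Rightarrow> ('i \<Rightarrow> 'a::metric_space \<Rightarrow> 'a) \<Rightarrow> 'a set \<Rightarrow> 'a set" where
  "inhom_attractor I S C =
     (THE F. compact F \<and> F \<noteq> {} \<and> F = (\<Union>i\<in>I. S i ` F) \<union> C)"

definition attractor :: "'i set \<Rightarrow> ('i \<Rightarrow> 'a::metric_space \<Rightarrow> 'a) \<Rightarrow> 'a set" where
  "attractor I S = inhom_attractor I S {}"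

definition mesh_count :: "real \<Rightarrow> (real ^ 'n) set \<Rightarrow> nat" where
  "mesh_count \<delta> E =
     card {k :: 'n \<Rightarrow> int. \<exists>x\<in>E. \<forall>i. of_int (k i) * \<delta> \<le> x $ i \<and> x $ i < (of_int (k i) + 1) * \<delta>}"

definition lower_box_dim :: "(real ^ 'n) set \<Rightarrow> ereal" where
  "lower_box_dim E =
     Liminf (at_right 0) (\<lambda>\<delta>. ereal (ln (real (mesh_count \<delta> E)) / (- ln \<delta>)))"

end

theory Submission
  imports Defs "HOL-Computational_Algebra.Primes"
begin

text \<open>All maps are \<open>x \<mapsto> \<theta> g(x)\<close> with a common ratio \<open>\<theta>\<close> close to 1, where \<open>g\<close> is the identity or the
  rotation of a coordinate 3-space given by one of the quaternions \<open>1 \<plusminus> 2i, 1 \<plusminus> 2j, 1 \<plusminus> 2k\<close> of norm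
  5. The attractor is the origin, and \<open>F\<^sub>C\<close> contains \<open>\<theta>\<^sup>L\<close> times the set of images of \<open>c\<close> under words
  of length \<open>L\<close>. It suffices that words of length \<open>O(m)\<close> move every \<open>c\<close> to almost as many cells of
  size \<open>5\<^sup>-\<^sup>m\<close> as the whole sphere has, namely \<open>5\<close> to the power \<open>m(d - 1 - \<eta>)\<close>: passing from
  \<open>5\<^sup>-\<^sup>m\<close> to \<open>\<theta>\<^sup>L 5\<^sup>-\<^sup>m\<close> then costs arbitrarily little as \<open>\<theta> \<rightarrow> 1\<close>.

  For \<open>d = 3\<close> this is a second moment estimate. The reduced words of length \<open>3m\<close> are distinct
  integer quaternions of norm \<open>5\<^sup>3\<^sup>m\<close>. If two of them are close, then, after removal of the common
  prefix, \<open>a\<^sup>-\<^sup>1 a'\<close> is an integer quaternion close to a scalar; such quaternions are counted by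
  choosing the first two coordinates freely and using that an integer \<open>n\<close> is a sum of two squares in
  \<open>O(n\<^sup>\<epsilon>)\<close> ways. So the words spread over the rotation group at scale \<open>5\<^sup>-\<^sup>m\<close>, and dividing by
  the size of the stabiliser, they spread over every orbit on the 2-sphere. Higher dimensions follow by
  induction: a 3-dimensional rotation produces many values of one coordinate, and each slice is
  treated by the induction hypothesis.\<close>

section \<open>Divisors and sums of two squares\<close>

lemma card_divisors_prime_power_mult:
  fixes p m a :: nat
  assumes "prime p" "m > 0"
  shows "card {d. d dvd p ^ a * m} \<le> (a + 1) * card {d. d dvd m}"
proof -
  have "{d. d dvd p ^ a * m} \<subseteq> (\<lambda>(i, e). p ^ i * e) ` ({..a} \<times> {d. d dvd m})"
  proof
    fix d assume "d \<in> {d. d dvd p ^ a * m}"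
    then obtain b e where be: "d = b * e" "b dvd p ^ a" "e dvd m"
      using division_decomp by blast
    then obtain i where "i \<le> a" "b = p ^ i"
      using divides_primepow_nat assms(1) by blast
    with be show "d \<in> (\<lambda>(i, e). p ^ i * e) ` ({..a} \<times> {d. d dvd m})"
      by (intro image_eqI[where x = "(i, e)"]) auto
  qed
  moreover have fin: "finite {d. d dvd m}" using assms by simp
  ultimately have "card {d. d dvd p ^ a * m} \<le> card ({..a} \<times> {d. d dvd m})"
    by (intro surj_card_le) auto
  then show ?thesis by (simp add: card_cartesian_product)
qed

text \<open>Bernoulli's inequality. It lets a factor linear in an exponent be absorbed into an
  arbitrarily small exponential loss.\<close>

lemma linear_le_exponential:
  fixes b :: real
  assumes "b > 1"
  shows "\<exists>K\<ge>1. \<forall>a::nat. real a + 1 \<le> K * b ^ a"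
proof -
  \<comment> \<open>Capping at 1 gives \<open>t * (real a + 1) \<le> 1 + real a * t\<close>, so that
    \<open>K = 1 / t\<close> works.\<close>
  define t where "t = min (b - 1) 1"
  have t: "0 < t" "t \<le> 1" "t \<le> b - 1" using assms by (auto simp: t_def)
  have "real a + 1 \<le> (1 / t) * b ^ a" for a :: nat
  proof -
    have "1 + real a * t \<le> (1 + t) ^ a"
      by (rule Bernoulli_inequality) (use t in auto)
    also have "\<dots> \<le> b ^ a" by (rule power_mono) (use t in auto)
    finally have "1 + real a * t \<le> b ^ a" .
    moreover have "t * (real a + 1) \<le> 1 + real a * t" using t by (simp add: algebra_simps)
    ultimately have "t * (real a + 1) \<le> b ^ a" by linarith
    then show ?thesis using t by (simp add: field_simps)
  qed
  moreover have "1 / t \<ge> 1" using t by simp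
  ultimately show ?thesis by blast
qed

text \<open>Strip a full prime power \<open>p ^ a\<close> from \<open>n\<close>, at the cost of a
  factor \<open>a + 1\<close>. If \<open>p\<close> is at least
  \<open>2 powr (1 / \<epsilon>)\<close>, then \<open>p powr \<epsilon>\<close> is at least 2 and
  its \<open>a\<close>-th power pays for this factor alone; each of the finitely many smaller primes
  costs a further constant \<open>K\<close>.\<close>

lemma divisor_bound:
  fixes \<epsilon> :: real
  assumes "\<epsilon> > 0"
  shows "\<exists>C\<ge>1. \<forall>n::nat>0. real (card {d. d dvd n}) \<le> C * real n powr \<epsilon>"
proof -
  have "2 powr \<epsilon> > (1::real)" using assms by simp
  then obtain K where K: "K \<ge> 1" "\<And>a::nat. real a + 1 \<le> K * (2 powr \<epsilon>) ^ a"
    using linear_le_exponential by metis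
  obtain B :: nat where B: "real B \<ge> 2 powr (1 / \<epsilon>)" using real_arch_simple by blast
  define small where "small = (\<lambda>n::nat. {p. prime p \<and> p < B \<and> p dvd n})"
  have fin: "finite (small n)" for n by (rule finite_subset[of _ "{..<B}"]) (auto simp: small_def)
  \<comment> \<open>The exponent of \<open>K\<close> counts the small primes dividing
    \<open>n\<close>, so that the induction charges each of them once; it never exceeds
    \<open>B\<close>.\<close>
  have main: "real (card {d. d dvd n}) \<le> K ^ card (small n) * real n powr \<epsilon>" if "n > 0" for n
    using that
  proof (induction n rule: less_induct)
    case (less n)
    show ?case
    proof (cases "n = 1")
      case True
      then show ?thesis using K(1) by simp
    next
      case False
      then obtain p where p: "prime p" "p dvd n" using prime_factor_nat by blast
      define a where "a = multiplicity p n"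
      obtain m where m: "n = p ^ a * m" "\<not> p dvd m"
        using multiplicity_decompose'[of n p] less.prems p unfolding a_def
        by (metis not_gr_zero not_prime_unit)
      have "a \<noteq> 0" using m p by (metis mult.commute mult.right_neutral power_0)
      have p2: "p \<ge> 2" using p prime_ge_2_nat by blast
      have "m > 0" using m less.prems by (cases m) auto
      have "p ^ a > 1" using p2 \<open>a \<noteq> 0\<close> by (intro one_less_power) auto
      then have "m < n" using m \<open>m > 0\<close> by simp
      then have IH: "real (card {d. d dvd m}) \<le> K ^ card (small m) * real m powr \<epsilon>"
        using less.IH \<open>m > 0\<close> by blast
      have le: "real (card {d. d dvd n}) \<le> (real a + 1) * real (card {d. d dvd m})"
        using card_divisors_prime_power_mult[OF p(1) \<open>m > 0\<close>, of a] m
        by (metis (mono_tags) of_nat_1 of_nat_add of_nat_le_iff of_nat_mult)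
      have npow: "real n powr \<epsilon> = (real p powr \<epsilon>) ^ a * real m powr \<epsilon>"
        using m p2 by (simp add: powr_mult powr_power mult.commute flip: powr_realpow powr_powr)
          (simp add: powr_powr mult.commute)
      have "(real a + 1) * K ^ card (small m) \<le> K ^ card (small n) * (real p powr \<epsilon>) ^ a"
      proof (cases "p < B")
        case True
        then have "insert p (small m) \<subseteq> small n" "p \<notin> small m"
          using p m by (auto simp: small_def)
        then have "Suc (card (small m)) \<le> card (small n)"
          using card_mono[OF fin, of "insert p (small m)" n] fin by simp
        then have 1: "K * K ^ card (small m) \<le> K ^ card (small n)"
          using K(1) by (metis power_Suc power_increasing)
        have "(real a + 1) \<le> K * (2 powr \<epsilon>) ^ a" using K by blast
        also have "\<dots> \<le> K * (real p powr \<epsilon>) ^ a"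
          using K(1) p2 assms by (intro mult_left_mono power_mono powr_mono2) auto
        finally have "(real a + 1) * K ^ card (small m)
            \<le> K * (real p powr \<epsilon>) ^ a * K ^ card (small m)"
          using K(1) by (intro mult_right_mono) auto
        also have "\<dots> = (K * K ^ card (small m)) * (real p powr \<epsilon>) ^ a" by simp
        also have "\<dots> \<le> K ^ card (small n) * (real p powr \<epsilon>) ^ a"
          using 1 by (intro mult_right_mono) auto
        finally show ?thesis .
      next
        case False
        have "small m \<subseteq> small n" using m by (auto simp: small_def)
        then have 1: "K ^ card (small m) \<le> K ^ card (small n)"
          using K(1) fin by (intro power_increasing card_mono) auto
        have "2 = (2 powr (1 / \<epsilon>)) powr \<epsilon>" using assms by (simp add: powr_powr)
        also have "\<dots> \<le> real p powr \<epsilon>"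
          using False B assms by (intro powr_mono2) auto
        finally have "2 ^ a \<le> (real p powr \<epsilon>) ^ a" by (intro power_mono) auto
        moreover have "real a + 1 \<le> 2 ^ a"
          using Suc_leI[OF less_exp[of a]]
          by (metis Suc_eq_plus1 of_nat_1 of_nat_add of_nat_le_iff of_nat_numeral of_nat_power)
        ultimately have "real a + 1 \<le> (real p powr \<epsilon>) ^ a" by linarith
        then have "(real a + 1) * K ^ card (small m) \<le> (real p powr \<epsilon>) ^ a * K ^ card (small n)"
          using 1 K(1) by (intro mult_mono) auto
        then show ?thesis by (simp add: mult.commute)
      qed
      then have "(real a + 1) * K ^ card (small m) * real m powr \<epsilon>
          \<le> K ^ card (small n) * (real p powr \<epsilon>) ^ a * real m powr \<epsilon>"
        by (intro mult_right_mono) auto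
      moreover have "(real a + 1) * real (card {d. d dvd m})
          \<le> (real a + 1) * (K ^ card (small m) * real m powr \<epsilon>)"
        using IH by (intro mult_left_mono) auto
      ultimately show ?thesis using le unfolding npow mult.assoc by linarith
    qed
  qed
  have "card (small n) \<le> B" for n
    using card_mono[of "{..<B}" "small n"] by (auto simp: small_def)
  then have "K ^ card (small n) * real n powr \<epsilon> \<le> K ^ B * real n powr \<epsilon>" for n
    using K(1) by (intro mult_right_mono power_increasing) auto
  then have "\<forall>n::nat>0. real (card {d. d dvd n}) \<le> K ^ B * real n powr \<epsilon>"
    using main by (meson order_trans)
  moreover have "K ^ B \<ge> 1" using K(1) by simp
  ultimately show ?thesis by blast
qed


section \<open>Representations of an integer as a sum of two squares\<close>

definition two_squares :: "int \<Rightarrow> (int \<times> int) set" where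
  "two_squares n = {(x, y). x\<^sup>2 + y\<^sup>2 = n}"

lemma abs_le_of_square_le:
  fixes x n :: int
  assumes "x\<^sup>2 \<le> n"
  shows "\<bar>x\<bar> \<le> n"
proof -
  have "\<bar>x\<bar> * 1 \<le> \<bar>x\<bar> * \<bar>x\<bar>" if "x \<noteq> 0"
    using that by (intro mult_left_mono) auto
  then have "\<bar>x\<bar> \<le> x\<^sup>2" by (cases "x = 0") (auto simp: power2_eq_square)
  then show ?thesis using assms by linarith
qed

lemma finite_two_squares [simp]: "finite (two_squares n)"
proof (rule finite_subset)
  show "two_squares n \<subseteq> {-n..n} \<times> {-n..n}"
  proof
    fix z assume "z \<in> two_squares n"
    then obtain x y where z: "z = (x, y)" "x\<^sup>2 + y\<^sup>2 = n" by (auto simp: two_squares_def)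
    then have "x\<^sup>2 \<le> n" "y\<^sup>2 \<le> n" using zero_le_power2[of x] zero_le_power2[of y] by linarith+
    then have "\<bar>x\<bar> \<le> n" "\<bar>y\<bar> \<le> n" by (auto intro: abs_le_of_square_le)
    then show "z \<in> {-n..n} \<times> {-n..n}" using z by auto
  qed
qed auto

definition prim_two_squares :: "int \<Rightarrow> (int \<times> int) set" where
  "prim_two_squares n = {(x, y). x\<^sup>2 + y\<^sup>2 = n \<and> coprime x y}"

lemma prim_two_squares_coprime:
  assumes "(x, y) \<in> prim_two_squares n"
  shows "coprime x n" "coprime y n"
proof -
  have n: "n = x\<^sup>2 + y\<^sup>2" "coprime x y" using assms by (auto simp: prim_two_squares_def)
  have "coprime x (x\<^sup>2 + y\<^sup>2) = coprime x (y\<^sup>2)"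
    by (metis coprime_iff_gcd_eq_1 gcd_add_mult mult.commute power2_eq_square add.commute)
  then show "coprime x n" using n by simp
  have "coprime y (x\<^sup>2 + y\<^sup>2) = coprime y (x\<^sup>2)"
    by (metis coprime_iff_gcd_eq_1 gcd_add_mult mult.commute power2_eq_square add.commute)
  then show "coprime y n" using n by (simp add: coprime_commute)
qed

text \<open>Two primitive representations in the same class \<open>gcd n (x y\<^sub>0 - y x\<^sub>0) = d\<close> have a
  determinant divisible by \<open>lcm d (n / d)\<close>, and this is at least \<open>n / 2\<close>; since the determinant and
  the inner product have squares summing to \<open>n\<^sup>2\<close>, a class has at most ten elements.\<close>

lemma same_class_det:
  fixes x y x' y' x0 y0 n :: int
  assumes z0: "(x0, y0) \<in> prim_two_squares n"
    and z: "(x, y) \<in> prim_two_squares n" and z': "(x', y') \<in> prim_two_squares n"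
    and d: "gcd n (x * y0 - y * x0) = gcd n (x' * y0 - y' * x0)" and n: "n > 0"
  shows "n dvd 2 * (x * y' - x' * y)"
proof -
  define d where "d = gcd n (x * y0 - y * x0)"
  obtain m where m: "n = d * m" unfolding d_def by (meson dvd_def gcd_dvd1)
  have dpos: "d > 0" unfolding d_def using n by simp
  have A: "d dvd x * y0 - y * x0" "d dvd x' * y0 - y' * x0"
    unfolding d_def using d by (metis gcd_dvd2)+
  \<comment> \<open>The product \<open>(a * y0 - b * x0) * (a * y0 + b * x0)\<close> is a multiple
    of \<open>n = d * m\<close>. After cancelling \<open>d\<close>, the cofactor \<open>A\<close> of
    the first factor is coprime to \<open>m\<close>, so \<open>m\<close> has to divide the second
    factor.\<close>
  have mdvd: "m dvd a * y0 + b * x0"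
    if ab: "(a, b) \<in> prim_two_squares n" and g: "gcd n (a * y0 - b * x0) = d" for a b
  proof -
    obtain A where A: "a * y0 - b * x0 = d * A" using g by (metis dvd_def gcd_dvd2)
    have "gcd (d * m) (d * A) = d" using g A m by simp
    then have "d * gcd m A = d" using dpos by (simp add: gcd_mult_left abs_mult)
    then have "coprime m A" using dpos by (simp add: coprime_iff_gcd_eq_1)
    have "x0\<^sup>2 + y0\<^sup>2 = n" "a\<^sup>2 + b\<^sup>2 = n" using z0 ab by (auto simp: prim_two_squares_def)
    then have sq: "y0\<^sup>2 = n - x0\<^sup>2" "b\<^sup>2 = n - a\<^sup>2" by auto
    have "(a * y0 - b * x0) * (a * y0 + b * x0) = a\<^sup>2 * y0\<^sup>2 - b\<^sup>2 * x0\<^sup>2"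
      by (simp add: algebra_simps power2_eq_square)
    also have "\<dots> = n * (a\<^sup>2 - x0\<^sup>2)" unfolding sq by (simp add: algebra_simps)
    finally have "(a * y0 - b * x0) * (a * y0 + b * x0) = n * (a\<^sup>2 - x0\<^sup>2)" .
    then have "d * (A * (a * y0 + b * x0)) = d * (m * (a\<^sup>2 - x0\<^sup>2))" using A m by algebra
    then have "A * (a * y0 + b * x0) = m * (a\<^sup>2 - x0\<^sup>2)" using dpos by simp
    then show ?thesis using \<open>coprime m A\<close> by (metis coprime_dvd_mult_right_iff dvd_triv_left)
  qed
  have B: "m dvd x * y0 + y * x0" "m dvd x' * y0 + y' * x0"
    using mdvd z z' d unfolding d_def by auto
  have cy0: "coprime y0 n" using prim_two_squares_coprime[OF z0] by simp
  have cx: "coprime x n" using prim_two_squares_coprime[OF z] by simp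
  define D where "D = x * y' - x' * y"
  have "y0 * D = y' * (x * y0 - y * x0) - y * (x' * y0 - y' * x0)" by (simp add: D_def algebra_simps)
  then have "d dvd y0 * D" using A by (metis dvd_diff dvd_mult)
  then have dD: "d dvd D" using cy0 m
    by (metis coprime_commute coprime_dvd_mult_right_iff coprime_mult_left_iff)
  have "y0 * D = y' * (x * y0 + y * x0) - y * (x' * y0 + y' * x0)" by (simp add: D_def algebra_simps)
  then have "m dvd y0 * D" using B by (metis dvd_diff dvd_mult)
  then have mD: "m dvd D" using cy0 m
    by (metis coprime_commute coprime_dvd_mult_right_iff coprime_mult_left_iff)
  \<comment> \<open>A common divisor of \<open>d\<close> and \<open>m\<close> divides this sum,
    which is \<open>2 * (x * y0)\<close>, while \<open>x\<close> and \<open>y0\<close> are prime to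
    \<open>n\<close>. So it divides 2; this is the source of the factor 2 in the conclusion.\<close>
  have "gcd d m dvd (x * y0 - y * x0) + (x * y0 + y * x0)"
    using A(1) B(1) by (meson dvd_add dvd_trans gcd_dvd1 gcd_dvd2)
  then have "gcd d m dvd 2 * (x * y0)" by (simp add: algebra_simps)
  moreover have "coprime (gcd d m) (x * y0)"
    using cx cy0 m by (metis coprime_commute coprime_mult_left_iff coprime_mult_right_iff
        coprime_divisors dvd_refl gcd_dvd1)
  ultimately have "gcd d m dvd 2" by (simp add: coprime_dvd_mult_left_iff)
  have "lcm d m dvd D" using dD mD by simp
  then have "gcd d m * lcm d m dvd 2 * D" using \<open>gcd d m dvd 2\<close> by (intro mult_dvd_mono) auto
  moreover have "gcd d m * lcm d m = n"
    using n dpos m by (metis abs_of_pos gcd_mult_lcm prod_gcd_lcm_int abs_mult)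
  ultimately show ?thesis by (simp add: D_def)
qed

lemma card_class_le:
  fixes n :: int
  assumes n: "n > 0" and z0: "(x0, y0) \<in> prim_two_squares n"
  shows "card {(x, y) \<in> prim_two_squares n. gcd n (x * y0 - y * x0) = d} \<le> 10"
proof (cases "{(x, y) \<in> prim_two_squares n. gcd n (x * y0 - y * x0) = d} = {}")
  case True
  then show ?thesis by (simp only: card.empty)
next
  case False
  let ?T = "{(x, y) \<in> prim_two_squares n. gcd n (x * y0 - y * x0) = d}"
  obtain x y where xy: "(x, y) \<in> ?T" using False by auto
  \<comment> \<open>Five possible multiples of \<open>n / 2\<close> for the determinant against
    \<open>(x, y)\<close>, times two signs of the inner product, give the bound 10.\<close>
  define f where "f = (\<lambda>(x', y'). (2 * (x * y' - x' * y) div n, 0 \<le> x * x' + y * y'))"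
  have xyn: "x\<^sup>2 + y\<^sup>2 = n" using xy by (auto simp: prim_two_squares_def)
  have norm: "(x * y' - x' * y)\<^sup>2 + (x * x' + y * y')\<^sup>2 = n\<^sup>2" if "(x', y') \<in> ?T" for x' y'
  proof -
    have "x'\<^sup>2 + y'\<^sup>2 = n" using that by (auto simp: prim_two_squares_def)
    moreover have "(x * y' - x' * y)\<^sup>2 + (x * x' + y * y')\<^sup>2 = (x\<^sup>2 + y\<^sup>2) * (x'\<^sup>2 + y'\<^sup>2)"
      by (simp add: power2_eq_square algebra_simps)
    ultimately show ?thesis using xyn by (simp add: power2_eq_square)
  qed
  have dv: "n dvd 2 * (x * y' - x' * y)" if "(x', y') \<in> ?T" for x' y'
    using same_class_det[OF z0 _ _ _ n] xy that by auto
  have inj: "inj_on f ?T"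
  proof (rule inj_onI)
    fix z z' assume z: "z \<in> ?T" and z': "z' \<in> ?T" and eq: "f z = f z'"
    obtain a b a' b' where ab: "z = (a, b)" "z' = (a', b')" by (cases z; cases z') auto
    have D: "x * b - a * y = x * b' - a' * y"
      using eq dv[of a b] dv[of a' b'] z z' n unfolding ab f_def by (auto elim!: dvdE)
    have "(x * a + y * b)\<^sup>2 = (x * a' + y * b')\<^sup>2"
      using norm[of a b] norm[of a' b'] z z' D unfolding ab by auto
    moreover have "0 \<le> x * a + y * b \<longleftrightarrow> 0 \<le> x * a' + y * b'" using eq unfolding ab f_def by simp
    ultimately have E: "x * a + y * b = x * a' + y * b'" unfolding power2_eq_iff by linarith
    have "n * a = x * (x * a + y * b) - y * (x * b - a * y)"
      "n * a' = x * (x * a' + y * b') - y * (x * b' - a' * y)"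
      "n * b = y * (x * a + y * b) + x * (x * b - a * y)"
      "n * b' = y * (x * a' + y * b') + x * (x * b' - a' * y)"
      unfolding xyn[symmetric] by (simp_all add: power2_eq_square algebra_simps)
    then have "n * a = n * a'" "n * b = n * b'" using D E by simp_all
    then show "z = z'" using n ab by simp
  qed
  have "f ` ?T \<subseteq> {-2..2} \<times> UNIV"
  proof
    fix w assume "w \<in> f ` ?T"
    then obtain a b where ab: "(a, b) \<in> ?T" "w = f (a, b)" by auto
    obtain k where k: "2 * (x * b - a * y) = n * k" using dv[OF ab(1)] by (auto elim: dvdE)
    have "(x * b - a * y)\<^sup>2 \<le> n\<^sup>2" using norm[OF ab(1)] zero_le_power2[of "x * a + y * b"] by linarith
    then have "\<bar>x * b - a * y\<bar> \<le> n" using n by (metis abs_le_square_iff abs_of_pos)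
    then have "\<bar>n * k\<bar> \<le> 2 * n" unfolding k[symmetric] by (simp add: abs_mult)
    then have "n * \<bar>k\<bar> \<le> n * 2" using n by (simp add: abs_mult)
    then have "\<bar>k\<bar> \<le> 2" using n by simp
    then show "w \<in> {-2..2} \<times> UNIV" using ab k n by (auto simp: f_def)
  qed
  then have "card (f ` ?T) \<le> card ({-2..2::int} \<times> (UNIV :: bool set))" by (intro card_mono) auto
  then show ?thesis using card_image[OF inj] by (simp add: card_cartesian_product)
qed

text \<open>Once one primitive representation is fixed as reference, all of them fall into classes
  indexed by the divisors of \<open>n\<close>.\<close>

lemma card_prim_two_squares_le:
  assumes "n > 0"
  shows "card (prim_two_squares (int n)) \<le> 10 * card {d. d dvd n}"
proof (cases "prim_two_squares (int n) = {}")
  case True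
  then show ?thesis by simp
next
  case False
  then obtain x0 y0 where z0: "(x0, y0) \<in> prim_two_squares (int n)" by auto
  let ?T = "\<lambda>d. {(x, y) \<in> prim_two_squares (int n). gcd (int n) (x * y0 - y * x0) = int d}"
  have fin: "finite (prim_two_squares (int n))"
    by (rule finite_subset[OF _ finite_two_squares[of "int n"]])
      (auto simp: prim_two_squares_def two_squares_def)
  have "prim_two_squares (int n) \<subseteq> (\<Union>d\<in>{d. d dvd n}. ?T d)"
  proof
    fix z assume z: "z \<in> prim_two_squares (int n)"
    obtain x y where xy: "z = (x, y)" by (cases z)
    define d where "d = nat (gcd (int n) (x * y0 - y * x0))"
    have "int d = gcd (int n) (x * y0 - y * x0)" by (simp add: d_def)
    moreover from this have "d dvd n" by (metis gcd_dvd1 int_dvd_int_iff)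
    ultimately show "z \<in> (\<Union>d\<in>{d. d dvd n}. ?T d)" using z xy by auto
  qed
  then have "card (prim_two_squares (int n)) \<le> card (\<Union>d\<in>{d. d dvd n}. ?T d)"
    by (intro card_mono finite_UN_I finite_subset[OF _ fin]) (use assms in auto)
  also have "\<dots> \<le> (\<Sum>d\<in>{d. d dvd n}. card (?T d))" using assms by (intro card_UN_le) auto
  also have "\<dots> \<le> (\<Sum>d\<in>{d. d dvd n}. 10)"
    using assms z0 by (intro sum_mono card_class_le) auto
  finally show ?thesis by simp
qed

text \<open>Dividing by the gcd \<open>g\<close> of the coordinates turns a representation of
  \<open>n\<close> into a primitive one of \<open>n div g\<^sup>2\<close>. The bound
  \<open>M\<close> serves twice: for the number of possible \<open>g\<close>, and for the primitive
  representations belonging to each.\<close>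

lemma card_two_squares_le:
  assumes n: "n > 0" and M: "\<And>m. m > 0 \<Longrightarrow> m \<le> n \<Longrightarrow> card {d. d dvd m} \<le> M"
  shows "card (two_squares (int n)) \<le> 10 * M * M"
proof -
  define G where "G = {g. g dvd n \<and> g\<^sup>2 dvd n}"
  let ?P = "\<lambda>g. (\<lambda>(x, y). (int g * x, int g * y)) ` prim_two_squares (int (n div g\<^sup>2))"
  have finG: "finite G" using n by (auto simp: G_def)
  have finP: "finite (prim_two_squares k)" for k
    by (rule finite_subset[OF _ finite_two_squares[of k]])
      (auto simp: prim_two_squares_def two_squares_def)
  have "two_squares (int n) \<subseteq> (\<Union>g\<in>G. ?P g)"
  proof
    fix z assume "z \<in> two_squares (int n)"
    then obtain x y where z: "z = (x, y)" "x\<^sup>2 + y\<^sup>2 = int n" by (auto simp: two_squares_def)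
    define g where "g = nat (gcd x y)"
    have g: "int g = gcd x y" by (simp add: g_def)
    have "gcd x y \<noteq> 0" using z n by auto
    then obtain a b where ab: "x = a * gcd x y" "y = b * gcd x y" "coprime a b"
      using gcd_coprime_exists[of x y] by blast
    have "int n = (a * gcd x y)\<^sup>2 + (b * gcd x y)\<^sup>2" using z(2) ab(1,2) by simp
    then have eq: "int n = (int g)\<^sup>2 * (a\<^sup>2 + b\<^sup>2)" unfolding g by (simp add: power2_eq_square algebra_simps)
    then have "(int g)\<^sup>2 dvd int n" by simp
    then have g2: "g\<^sup>2 dvd n" by (metis int_dvd_int_iff of_nat_power)
    then have "g dvd n" by (metis dvd_trans dvd_triv_left power2_eq_square)
    have "int (n div g\<^sup>2) = a\<^sup>2 + b\<^sup>2"
      using eq \<open>gcd x y \<noteq> 0\<close> g by (simp add: zdiv_int)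
    then have "(a, b) \<in> prim_two_squares (int (n div g\<^sup>2))"
      using ab by (simp add: prim_two_squares_def)
    moreover have "z = (int g * a, int g * b)" using z ab g by (metis mult.commute)
    ultimately show "z \<in> (\<Union>g\<in>G. ?P g)"
      using g2 \<open>g dvd n\<close> by (auto simp: G_def intro!: bexI[of _ g])
  qed
  then have "card (two_squares (int n)) \<le> card (\<Union>g\<in>G. ?P g)"
    by (intro card_mono finite_UN_I finG finite_imageI finP)
  also have "\<dots> \<le> (\<Sum>g\<in>G. card (?P g))" by (rule card_UN_le[OF finG])
  also have "\<dots> \<le> (\<Sum>g\<in>G. 10 * M)"
  proof (rule sum_mono)
    fix g assume "g \<in> G"
    then have g: "g\<^sup>2 dvd n" by (simp add: G_def)
    then have "n div g\<^sup>2 > 0" using n by (metis div_greater_zero_iff dvd_imp_le gr0I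
          dvd_0_left_iff neq0_conv)
    then have "card (prim_two_squares (int (n div g\<^sup>2))) \<le> 10 * M"
      using card_prim_two_squares_le[of "n div g\<^sup>2"] M[of "n div g\<^sup>2"] by force
    then show "card (?P g) \<le> 10 * M" using card_image_le[OF finP] le_trans by blast
  qed
  also have "\<dots> = card G * (10 * M)" by simp
  also have "card G \<le> card {d. d dvd n}" using n by (intro card_mono) (auto simp: G_def)
  then have "card G \<le> M" using M[of n] n by simp
  then have "card G * (10 * M) \<le> 10 * M * M" by simp
  finally show ?thesis .
qed

text \<open>The divisor bound enters squared, so it is applied with \<open>\<epsilon> / 2\<close>.
  Bounding in terms of \<open>X\<close> gives one constant for a whole range of \<open>n\<close>,
  with 0 included.\<close>

lemma two_squares_bound:
  fixes \<epsilon> :: real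
  assumes "\<epsilon> > 0"
  shows "\<exists>C\<ge>1. \<forall>n X. n \<le> X \<longrightarrow> X \<ge> 1 \<longrightarrow> real (card (two_squares (int n))) \<le> C * real X powr \<epsilon>"
proof -
  obtain C where C: "C \<ge> 1" "\<And>n::nat. n > 0 \<Longrightarrow> real (card {d. d dvd n}) \<le> C * real n powr (\<epsilon> / 2)"
    using divisor_bound[of "\<epsilon> / 2"] assms by auto
  have "real (card (two_squares (int n))) \<le> (10 * C\<^sup>2) * real X powr \<epsilon>" if "n \<le> X" "X \<ge> 1" for n X
  proof (cases "n = 0")
    case True
    have "two_squares 0 = {(0, 0)}" by (auto simp: two_squares_def sum_power2_eq_zero_iff)
    then have "real (card (two_squares (int n))) = 1 * 1" using True by simp
    also have "\<dots> \<le> (10 * C\<^sup>2) * real X powr \<epsilon>"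
    proof (rule mult_mono)
      show "1 \<le> 10 * C\<^sup>2" using C(1) one_le_power[of C 2] by linarith
      show "1 \<le> real X powr \<epsilon>" using that assms by (intro ge_one_powr_ge_zero) auto
    qed auto
    finally show ?thesis .
  next
    case False
    define Y where "Y = C * real X powr (\<epsilon> / 2)"
    define M where "M = nat \<lfloor>Y\<rfloor>"
    have Y0: "Y \<ge> 0" using C(1) by (simp add: Y_def)
    have "card {d. d dvd m} \<le> M" if "m > 0" "m \<le> n" for m
    proof -
      have "real (card {d. d dvd m}) \<le> C * real m powr (\<epsilon> / 2)" using C(2) that by blast
      also have "\<dots> \<le> Y" unfolding Y_def
        using that \<open>n \<le> X\<close> C(1) assms by (intro mult_left_mono powr_mono2) auto
      finally show ?thesis unfolding M_def using Y0 by (simp add: le_nat_floor)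
    qed
    then have "card (two_squares (int n)) \<le> 10 * M * M" using False by (intro card_two_squares_le) auto
    then have "real (card (two_squares (int n))) \<le> 10 * real M * real M"
      by (metis of_nat_le_iff of_nat_mult of_nat_numeral)
    also have "\<dots> \<le> 10 * Y * Y" unfolding M_def using Y0 by (intro mult_mono) auto
    also have "\<dots> = (10 * C\<^sup>2) * (real X powr (\<epsilon> / 2) * real X powr (\<epsilon> / 2))"
      by (simp add: Y_def power2_eq_square)
    also have "\<dots> = (10 * C\<^sup>2) * real X powr \<epsilon>" by (simp flip: powr_add)
    finally show ?thesis .
  qed
  moreover have "1 \<le> 10 * C\<^sup>2" using C(1) one_le_power[of C 2] by linarith
  ultimately show ?thesis by blast
qed

corollary two_squares_bound_int:
  fixes \<epsilon> :: real
  assumes "\<epsilon> > 0"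
  shows "\<exists>C\<ge>1. \<forall>n X. n \<le> int X \<longrightarrow> X \<ge> 1 \<longrightarrow> real (card (two_squares n)) \<le> C * real X powr \<epsilon>"
proof -
  obtain C where C: "C \<ge> 1"
    "\<And>n X. n \<le> X \<Longrightarrow> X \<ge> 1 \<Longrightarrow> real (card (two_squares (int n))) \<le> C * real X powr \<epsilon>"
    using two_squares_bound[OF assms] by blast
  have "real (card (two_squares n)) \<le> C * real X powr \<epsilon>" if "n \<le> int X" "X \<ge> 1" for n X
  proof (cases "n \<ge> 0")
    case True
    then show ?thesis using C(2)[of "nat n" X] that by simp
  next
    case False
    have "x\<^sup>2 + y\<^sup>2 \<noteq> n" for x y :: int using False sum_power2_ge_zero[of x y] by linarith
    then have "two_squares n = {}" by (auto simp: two_squares_def)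
    then show ?thesis using C(1) by simp
  qed
  with C(1) show ?thesis by blast
qed

lemma card_int_interval_le:
  fixes a b :: real
  assumes "a \<le> b + 1"
  shows "real (card {\<lceil>a\<rceil>..\<lfloor>b\<rfloor>}) \<le> b - a + 1"
  using assms by simp linarith

section \<open>Reduced words in integer quaternions\<close>

datatype 'a quat = Quat (qre: 'a) (qi: 'a) (qj: 'a) (qk: 'a)

instantiation quat :: (comm_ring_1) ring_1
begin

definition "0 = Quat 0 0 0 0"
definition "1 = Quat 1 0 0 0"
definition "p + q = Quat (qre p + qre q) (qi p + qi q) (qj p + qj q) (qk p + qk q)"
definition "p - q = Quat (qre p - qre q) (qi p - qi q) (qj p - qj q) (qk p - qk q)"
definition "- q = Quat (- qre q) (- qi q) (- qj q) (- qk q)"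
definition "p * q = Quat
  (qre p * qre q - qi p * qi q - qj p * qj q - qk p * qk q)
  (qre p * qi q + qi p * qre q + qj p * qk q - qk p * qj q)
  (qre p * qj q - qi p * qk q + qj p * qre q + qk p * qi q)
  (qre p * qk q + qi p * qj q - qj p * qi q + qk p * qre q)"

instance
proof
  fix a b c :: "'a quat"
  show "a * b * c = a * (b * c)"
    unfolding times_quat_def quat.sel quat.inject
    by (simp only: left_diff_distrib right_diff_distrib distrib_left distrib_right mult.assoc
        diff_conv_add_uminus minus_add_distrib minus_minus mult_minus_left mult_minus_right add_ac simp_thms)
qed (simp_all add: zero_quat_def one_quat_def plus_quat_def minus_quat_def uminus_quat_def
      times_quat_def distrib_left distrib_right)

end

definition qcnj :: "'a::comm_ring_1 quat \<Rightarrow> 'a quat" where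
  "qcnj q = Quat (qre q) (- qi q) (- qj q) (- qk q)"

definition qnrm :: "'a::comm_ring_1 quat \<Rightarrow> 'a" where
  "qnrm q = (qre q)\<^sup>2 + (qi q)\<^sup>2 + (qj q)\<^sup>2 + (qk q)\<^sup>2"

abbreviation qscalar :: "'a::comm_ring_1 \<Rightarrow> 'a quat" where
  "qscalar c \<equiv> Quat c 0 0 0"

lemma qcnj_qcnj [simp]: "qcnj (qcnj q) = q"
  by (simp add: qcnj_def)

lemma qcnj_mult: "qcnj (p * q) = qcnj q * qcnj p"
  by (simp add: qcnj_def times_quat_def algebra_simps)

lemma qcnj_one [simp]: "qcnj 1 = 1"
  by (simp add: qcnj_def one_quat_def)

lemma qnrm_one [simp]: "qnrm 1 = 1"
  by (simp add: qnrm_def one_quat_def)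

lemma qnrm_qcnj [simp]: "qnrm (qcnj q) = qnrm q"
  by (simp add: qnrm_def qcnj_def)

lemma qnrm_mult: "qnrm (p * q) = qnrm p * qnrm q"
  by (simp add: qnrm_def times_quat_def power2_eq_square algebra_simps)

lemma qcnj_mult_self: "qcnj q * q = qscalar (qnrm q)"
  by (simp add: qnrm_def qcnj_def times_quat_def power2_eq_square algebra_simps)

lemma qscalar_mult: "qscalar c * q = Quat (c * qre q) (c * qi q) (c * qj q) (c * qk q)"
  by (simp add: times_quat_def)

section \<open>The six letters of norm 5 and their reduced words\<close>

definition letters :: "int quat set" where
  "letters = {Quat 1 2 0 0, Quat 1 (- 2) 0 0, Quat 1 0 2 0, Quat 1 0 (- 2) 0,
    Quat 1 0 0 2, Quat 1 0 0 (- 2)}"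

lemma finite_letters [simp]: "finite letters"
  by (simp add: letters_def)

lemma card_letters: "card letters = 6"
  by (simp add: letters_def)

lemma letters_qnrm: "a \<in> letters \<Longrightarrow> qnrm a = 5"
  by (auto simp: letters_def qnrm_def)

lemma letters_qcnj:
  assumes "a \<in> letters"
  shows "qcnj a \<in> letters"
proof -
  have "\<forall>a\<in>letters. qcnj a \<in> letters" by (simp add: letters_def qcnj_def)
  with assms show ?thesis by blast
qed

lemma letters_diff:
  assumes "a \<in> letters" "b \<in> letters" "a \<noteq> b"
  shows "qnrm (a - b) = 8 \<or> qnrm (a - b) = 16"
proof -
  have "\<forall>a\<in>letters. \<forall>b\<in>letters. a = b \<or> qnrm (a - b) = 8 \<or> qnrm (a - b) = 16"
    by (simp add: letters_def qnrm_def minus_quat_def)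
  with assms show ?thesis by blast
qed

definition div5 :: "int quat \<Rightarrow> bool" where
  "div5 q \<longleftrightarrow> 5 dvd qre q \<and> 5 dvd qi q \<and> 5 dvd qj q \<and> 5 dvd qk q"

lemma div5_mult: "div5 q \<Longrightarrow> div5 (p * q)"
  by (simp add: div5_def times_quat_def)

lemma div5_diff: "div5 p \<Longrightarrow> div5 q \<Longrightarrow> div5 (p - q)"
  by (simp add: div5_def minus_quat_def)

lemma div5_qscalar: "div5 (qscalar 5 * q)"
  by (simp add: div5_def qscalar_mult)

text \<open>A left annihilator modulo 5 containing two distinct letters contains their difference, which is
  invertible modulo 5.\<close>

lemma div5_two_letters:
  assumes "a \<in> letters" "b \<in> letters" "a \<noteq> b" "div5 (a * p)" "div5 (b * p)"
  shows "div5 p"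
proof -
  have "div5 (qcnj (a - b) * (a * p - b * p))"
    by (rule div5_mult, rule div5_diff) (use assms in auto)
  also have "qcnj (a - b) * (a * p - b * p) = qscalar (qnrm (a - b)) * p"
    by (simp only: mult.assoc[symmetric] left_diff_distrib[symmetric] qcnj_mult_self)
  finally have *: "div5 (qscalar (qnrm (a - b)) * p)" .
  have "5 dvd x" if "5 dvd qnrm (a - b) * x" for x :: int
  proof -
    consider "qnrm (a - b) = 8" | "qnrm (a - b) = 16" using letters_diff[OF assms(1-3)] by blast
    then have "5 dvd 8 * x \<or> 5 dvd 16 * x" using that by cases (simp_all only: simp_thms)
    then show ?thesis by presburger
  qed
  with * show ?thesis unfolding div5_def qscalar_mult quat.sel by blast
qed

text \<open>Conjugation inverts a letter up to the scalar 5, so these are the reduced words of a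
  free group on three generators.\<close>

definition reduced :: "int quat list \<Rightarrow> bool" where
  "reduced ws \<longleftrightarrow> set ws \<subseteq> letters \<and> successively (\<lambda>a b. b \<noteq> qcnj a) ws"

lemma reduced_Nil [simp]: "reduced []"
  by (simp add: reduced_def)

lemma reduced_Cons:
  "reduced (a # ws) \<longleftrightarrow> a \<in> letters \<and> reduced ws \<and> (ws \<noteq> [] \<longrightarrow> hd ws \<noteq> qcnj a)"
  by (auto simp: reduced_def successively_Cons)

lemma reduced_append:
  "reduced (us @ vs) \<longleftrightarrow>
    reduced us \<and> reduced vs \<and> (us \<noteq> [] \<longrightarrow> vs \<noteq> [] \<longrightarrow> hd vs \<noteq> qcnj (last us))"
  by (auto simp: reduced_def successively_append_iff)

lemma reduced_rev_qcnj: "reduced ws \<Longrightarrow> reduced (rev (map qcnj ws))"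
proof (induction ws)
  case (Cons a ws)
  then show ?case
    by (cases "ws = []") (auto simp: reduced_Cons reduced_append letters_qcnj last_rev hd_map)
qed simp

lemma prod_list_rev_qcnj: "prod_list (rev (map qcnj ws)) = qcnj (prod_list ws)"
  by (induction ws) (simp_all add: qcnj_mult)

lemma qnrm_prod_list: "set ws \<subseteq> letters \<Longrightarrow> qnrm (prod_list ws) = 5 ^ length ws"
  by (induction ws) (auto simp: qnrm_mult letters_qnrm)

lemma qcnj_letter_mult:
  assumes "a \<in> letters"
  shows "qcnj a * (a * p) = qscalar 5 * p"
  using assms by (simp add: mult.assoc[symmetric] qcnj_mult_self letters_qnrm)

text \<open>Induction on a word starting with \<open>a\<close>, \<open>b\<close>: the letter
  \<open>qcnj b\<close> annihilates the product of the tail modulo 5. If \<open>a\<close>, which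
  differs from \<open>qcnj b\<close>, did so as well, the tail would already be divisible by
  5.\<close>

lemma reduced_not_div5: "reduced ws \<Longrightarrow> \<not> div5 (prod_list ws)"
proof (induction ws)
  case Nil
  then show ?case by (simp add: div5_def one_quat_def)
next
  case (Cons a ws)
  show ?case
  proof (cases ws)
    case Nil
    then show ?thesis using Cons.prems by (auto simp: reduced_Cons letters_def div5_def)
  next
    case (Cons b vs)
    have red: "a \<in> letters" "b \<in> letters" "reduced ws" "a \<noteq> qcnj b"
      using Cons.prems Cons by (auto simp: reduced_Cons)
    have "div5 (qcnj b * prod_list ws)"
      using Cons red div5_qscalar by (simp add: qcnj_letter_mult)
    then show ?thesis
      using div5_two_letters[of a "qcnj b" "prod_list ws"] Cons.IH red by (auto simp: letters_qcnj)
  qed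
qed

lemma qscalar_cancel: "c \<noteq> 0 \<Longrightarrow> qscalar c * p = qscalar c * q \<Longrightarrow> p = (q :: 'a::idom quat)"
  by (cases p; cases q) (simp add: qscalar_mult)

text \<open>The first letter can be read off the product: its conjugate is the only letter that
  annihilates the product modulo 5. Cancel it and continue.\<close>

lemma reduced_prod_inj:
  assumes "reduced us" "reduced vs" "length us = length vs" "prod_list us = prod_list vs"
  shows "us = vs"
  using assms
proof (induction us arbitrary: vs)
  case (Cons a us)
  then obtain b vs' where vs: "vs = b # vs'" by (cases vs) auto
  have ab: "a \<in> letters" "b \<in> letters" using Cons.prems vs by (auto simp: reduced_Cons)
  have "prod_list (a # us) = b * prod_list vs'" using Cons.prems vs by simp
  then have "div5 (qcnj b * prod_list (a # us))" using ab by (simp add: qcnj_letter_mult div5_qscalar del: prod_list.Cons)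
  moreover have "div5 (qcnj a * prod_list (a # us))" using ab by (simp add: qcnj_letter_mult div5_qscalar)
  ultimately have "qcnj a = qcnj b"
    using div5_two_letters[of "qcnj a" "qcnj b" "prod_list (a # us)"]
      reduced_not_div5[OF Cons.prems(1)] ab letters_qcnj by blast
  then have "a = b" by (metis qcnj_qcnj)
  moreover have "qcnj a * (a * prod_list us) = qcnj a * (a * prod_list vs')"
    using Cons.prems(4) unfolding vs \<open>a = b\<close> by simp
  then have "qscalar 5 * prod_list us = qscalar 5 * prod_list vs'"
    using ab by (simp only: qcnj_letter_mult)
  then have "prod_list us = prod_list vs'" by (rule qscalar_cancel[rotated]) simp
  ultimately show ?case using Cons.IH[of vs'] Cons.prems vs by (auto simp: reduced_Cons)
qed simp

definition rwords :: "nat \<Rightarrow> int quat list set" where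
  "rwords k = {ws. reduced ws \<and> length ws = k}"

lemma finite_rwords [simp]: "finite (rwords k)"
  by (rule finite_subset[OF _ finite_lists_length_eq[OF finite_letters, of k]])
    (auto simp: rwords_def reduced_def)

lemma card_rwords_Suc: "card (rwords (Suc k)) = 6 * 5 ^ k"
proof (induction k)
  case 0
  have "rwords (Suc 0) = (\<lambda>a. [a]) ` letters"
    by (auto simp: rwords_def reduced_Cons length_Suc_conv)
  moreover have "inj_on (\<lambda>a. [a]) letters" by (simp add: inj_on_def)
  ultimately show ?case by (simp add: card_image card_letters del: One_nat_def)
next
  case (Suc k)
  have "rwords (Suc (Suc k)) =
      (\<lambda>(ws, a). a # ws) ` (SIGMA ws:rwords (Suc k). letters - {qcnj (hd ws)})"
    (is "_ = ?f ` ?S")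
  proof (intro set_eqI iffI)
    fix us assume "us \<in> rwords (Suc (Suc k))"
    then obtain a ws where "us = a # ws" "length ws = Suc k" "reduced (a # ws)"
      by (cases us) (auto simp: rwords_def)
    then show "us \<in> ?f ` ?S"
      by (intro image_eqI[where x = "(ws, a)"]) (auto simp: rwords_def reduced_Cons)
  next
    fix us assume "us \<in> ?f ` ?S"
    then show "us \<in> rwords (Suc (Suc k))"
      by (auto simp: rwords_def reduced_Cons)
  qed
  moreover have "inj_on ?f ?S" by (auto simp: inj_on_def)
  ultimately have "card (rwords (Suc (Suc k))) = card ?S" by (simp add: card_image)
  also have "\<dots> = (\<Sum>ws\<in>rwords (Suc k). card (letters - {qcnj (hd ws)}))"
    by (intro card_SigmaI) auto
  also have "\<dots> = (\<Sum>ws\<in>rwords (Suc k). 5)"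
  proof (intro sum.cong refl)
    fix ws assume "ws \<in> rwords (Suc k)"
    then have "hd ws \<in> letters" by (cases ws) (auto simp: rwords_def reduced_Cons)
    then show "card (letters - {qcnj (hd ws)}) = 5"
      by (simp add: card_Diff_singleton letters_qcnj card_letters)
  qed
  finally show ?case using Suc by simp
qed

lemma card_rwords_bounds: "5 ^ k \<le> card (rwords k)" "card (rwords k) \<le> 2 * 5 ^ k"
proof -
  have "rwords 0 = {[]}" by (auto simp: rwords_def)
  then show "5 ^ k \<le> card (rwords k)" "card (rwords k) \<le> 2 * 5 ^ k"
    by (cases k; simp add: card_rwords_Suc)+
qed

section \<open>Pairs of words that are close as rotations\<close>

definition near_scalar :: "nat \<Rightarrow> real \<Rightarrow> int quat set" where
  "near_scalar l \<tau> =
    {g. qnrm g = 25 ^ l \<and> real_of_int (qnrm (g - qscalar (5 ^ l))) \<le> (\<tau> * 5 ^ l)\<^sup>2}"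

text \<open>Divided by \<open>N = 5 ^ l\<close>, these are unit quaternions within
  \<open>\<tau>\<close> of 1. For \<open>qnrm g = N\<^sup>2\<close> with real part \<open>x\<close>,
  the squared distance to \<open>N\<close> equals \<open>2 * N * (N - x)\<close>, so
  \<open>x\<close> lies within \<open>\<tau>\<^sup>2 * N / 2\<close> of \<open>N\<close>, a
  quadratically short interval. The second coordinate is at most \<open>\<tau> * N\<close> in size,
  and the last two represent what remains as a sum of two squares.\<close>

lemma near_scalar_bounds:
  fixes l \<tau>
  assumes "\<tau> \<ge> 0"
  defines "A \<equiv> {\<lceil>5 ^ l - \<tau>\<^sup>2 * 5 ^ l / 2\<rceil>..\<lfloor>5 ^ l :: real\<rfloor>}"
    and "B \<equiv> {\<lceil>- (\<tau> * 5 ^ l)\<rceil>..\<lfloor>\<tau> * 5 ^ l\<rfloor>}"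
  shows "near_scalar l \<tau> \<subseteq> (\<Union>(x, y)\<in>A \<times> B. (\<lambda>(c, d). Quat x y c d) ` two_squares (25 ^ l - x\<^sup>2 - y\<^sup>2))"
proof
  fix g assume g: "g \<in> near_scalar l \<tau>"
  obtain x y c d where gq: "g = Quat x y c d" by (cases g)
  define N :: int where "N = 5 ^ l"
  have N: "N\<^sup>2 = 25 ^ l" "N > 0" "real_of_int N = 5 ^ l"
    by (auto simp: N_def power_mult[symmetric] mult.commute power2_eq_square simp flip: power_mult_distrib)
  have n1: "x\<^sup>2 + y\<^sup>2 + c\<^sup>2 + d\<^sup>2 = N\<^sup>2" using g gq N by (simp add: near_scalar_def qnrm_def)
  have "x\<^sup>2 \<le> N\<^sup>2" using n1 zero_le_power2[of y] zero_le_power2[of c] zero_le_power2[of d] by linarith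
  then have xN: "x \<le> N" using N by (metis abs_le_square_iff abs_of_pos abs_le_D1)
  have "qnrm (g - qscalar N) = (x - N)\<^sup>2 + y\<^sup>2 + c\<^sup>2 + d\<^sup>2"
    by (simp add: gq qnrm_def minus_quat_def)
  then have q: "real_of_int ((x - N)\<^sup>2 + y\<^sup>2 + c\<^sup>2 + d\<^sup>2) \<le> (\<tau> * N)\<^sup>2"
    using g N by (simp add: near_scalar_def N_def)
  have "(x - N)\<^sup>2 + y\<^sup>2 + c\<^sup>2 + d\<^sup>2 = N * (2 * (N - x))"
    using n1 by (simp add: power2_eq_square algebra_simps)
  then have "real_of_int N * (2 * (N - x)) \<le> real_of_int N * (\<tau>\<^sup>2 * N)"
    using q by (metis (no_types, lifting) of_int_mult power2_eq_square mult.assoc mult.commute)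
  then have "2 * (real_of_int N - x) \<le> \<tau>\<^sup>2 * N" using N by simp
  then have xA: "x \<in> A"
    using xN unfolding A_def N(3)[symmetric] by (simp add: ceiling_le_iff algebra_simps)
  have "real_of_int (y\<^sup>2) \<le> real_of_int ((x - N)\<^sup>2 + y\<^sup>2 + c\<^sup>2 + d\<^sup>2)"
    unfolding of_int_le_iff
    using zero_le_power2[of "x - N"] zero_le_power2[of c] zero_le_power2[of d] by linarith
  then have "(real_of_int y)\<^sup>2 \<le> (\<tau> * N)\<^sup>2" using q by (metis of_int_power order_trans)
  then have "\<bar>real_of_int y\<bar> \<le> \<tau> * N" using assms(1) N
    by (metis abs_le_square_iff abs_of_nonneg mult_nonneg_nonneg of_int_0_le_iff order_less_imp_le)
  then have yB: "y \<in> B" unfolding B_def N(3)[symmetric] by (simp add: ceiling_le_iff le_floor_iff abs_le_iff)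
  have "(c, d) \<in> two_squares (25 ^ l - x\<^sup>2 - y\<^sup>2)"
    using n1 N by (auto simp: two_squares_def)
  then show "g \<in> (\<Union>(x, y)\<in>A \<times> B. (\<lambda>(c, d). Quat x y c d) ` two_squares (25 ^ l - x\<^sup>2 - y\<^sup>2))"
    using xA yB gq by force
qed

lemma finite_near_scalar:
  assumes "\<tau> \<ge> 0"
  shows "finite (near_scalar l \<tau>)"
  by (rule finite_subset[OF near_scalar_bounds[OF assms]]) auto

lemma card_near_scalar_le:
  assumes "\<tau> \<ge> 0" and M: "\<And>n. n \<le> 25 ^ l \<Longrightarrow> real (card (two_squares n)) \<le> M"
  shows "real (card (near_scalar l \<tau>)) \<le> (\<tau>\<^sup>2 * 5 ^ l / 2 + 1) * (2 * \<tau> * 5 ^ l + 1) * M"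
proof -
  define A where "A = {\<lceil>5 ^ l - \<tau>\<^sup>2 * 5 ^ l / 2\<rceil>..\<lfloor>5 ^ l :: real\<rfloor>}"
  define B where "B = {\<lceil>- (\<tau> * 5 ^ l)\<rceil>..\<lfloor>\<tau> * 5 ^ l\<rfloor>}"
  have cA: "real (card A) \<le> \<tau>\<^sup>2 * 5 ^ l / 2 + 1"
    unfolding A_def by (rule order_trans[OF card_int_interval_le]) (auto intro: order_trans[of _ 0])
  have "0 \<le> \<tau> * 5 ^ l" using assms(1) by simp
  then have cB: "real (card B) \<le> 2 * \<tau> * 5 ^ l + 1"
    unfolding B_def by (intro order_trans[OF card_int_interval_le]) auto
  have M0: "M \<ge> 0" using M[of 0] by (meson of_nat_0_le_iff order_trans zero_le_numeral zero_le_power)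
  let ?f = "\<lambda>(x, y). (\<lambda>(c, d). Quat x y c d) ` two_squares (25 ^ l - x\<^sup>2 - y\<^sup>2)"
  have "card (near_scalar l \<tau>) \<le> card (\<Union>z\<in>A \<times> B. ?f z)"
    using near_scalar_bounds[OF assms(1), of l] unfolding A_def[symmetric] B_def[symmetric]
    by (intro card_mono) (auto simp: A_def B_def)
  also have "\<dots> \<le> (\<Sum>z\<in>A \<times> B. card (?f z))"
    by (rule card_UN_le) (auto simp: A_def B_def)
  finally have "real (card (near_scalar l \<tau>)) \<le> real (\<Sum>z\<in>A \<times> B. card (?f z))"
    by (rule of_nat_mono)
  also have "\<dots> = (\<Sum>z\<in>A \<times> B. real (card (?f z)))" by simp
  also have "\<dots> \<le> (\<Sum>z\<in>A \<times> B. M)"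
  proof (rule sum_mono)
    fix z :: "int \<times> int"
    obtain x y where z: "z = (x, y)" by (cases z)
    have "card (?f z) \<le> card (two_squares (25 ^ l - x\<^sup>2 - y\<^sup>2))"
      unfolding z by (simp add: card_image_le)
    also have "real \<dots> \<le> M" by (rule M) (use zero_le_power2[of x] zero_le_power2[of y] in linarith)
    finally show "real (card (?f z)) \<le> M" by simp
  qed
  also have "\<dots> = real (card A) * real (card B) * M" by (simp add: card_cartesian_product)
  also have "\<dots> \<le> (\<tau>\<^sup>2 * 5 ^ l / 2 + 1) * (2 * \<tau> * 5 ^ l + 1) * M"
    using cA cB M0 assms(1) by (intro mult_mono) auto
  finally show ?thesis .
qed

text \<open>The products have length \<open>sqrt (5 ^ k)\<close>, so after normalisation the
  condition says that two unit quaternions are within \<open>\<tau>\<close> of each other.\<close>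

definition close_pairs :: "nat \<Rightarrow> real \<Rightarrow> (int quat list \<times> int quat list) set" where
  "close_pairs k \<tau> = {(u, v). u \<in> rwords k \<and> v \<in> rwords k \<and>
    real_of_int (qnrm (prod_list u - prod_list v)) \<le> \<tau>\<^sup>2 * 5 ^ k}"

lemma finite_close_pairs [simp]: "finite (close_pairs k \<tau>)"
  by (rule finite_subset[of _ "rwords k \<times> rwords k"]) (auto simp: close_pairs_def)

text \<open>Removing the longest common prefix of two words \<open>u = s a\<close> and \<open>v = s a'\<close> leaves a reduced word
  for \<open>a\<^sup>-\<^sup>1 a'\<close>, which determines \<open>a\<close> and \<open>a'\<close>.\<close>

lemma card_close_pairs_le:
  assumes "\<tau> \<ge> 0"
  shows "card (close_pairs k \<tau>) \<le> (\<Sum>l\<le>k. card (rwords (k - l)) * card (near_scalar l \<tau>))"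
proof -
  define D where "D = (SIGMA l:{..k}. rwords (k - l) \<times> near_scalar l \<tau>)"
  \<comment> \<open>A pair of words is encoded by the length \<open>l\<close> of what follows the
    common prefix, the prefix \<open>s\<close> itself, and the quaternion \<open>g\<close> standing
    for \<open>qcnj a * a'\<close>.\<close>
  define R where "R = (\<lambda>(u, v) (l, s, g). \<exists>a a'. u = s @ a \<and> v = s @ a' \<and> length a = l \<and>
    length a' = l \<and> reduced (rev (map qcnj a) @ a') \<and> g = prod_list (rev (map qcnj a) @ a'))"
  have "card (close_pairs k \<tau>) \<le> card D"
  proof (rule card_le_if_inj_on_rel[where r = R])
    show "finite D" unfolding D_def using finite_near_scalar[OF assms] by auto
  next
    fix p assume p: "p \<in> close_pairs k \<tau>"
    obtain u v where uv: "p = (u, v)" by (cases p)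
    have red: "reduced u" "reduced v" and len: "length u = k" "length v = k"
      and cl: "real_of_int (qnrm (prod_list u - prod_list v)) \<le> \<tau>\<^sup>2 * 5 ^ k"
      using p uv by (auto simp: close_pairs_def rwords_def)
    obtain s a a' where s: "u = s @ a" "v = s @ a'" "a = [] \<or> a' = [] \<or> hd a \<noteq> hd a'"
      using longest_common_prefix[of u v] by blast
    define l where "l = length a"
    have la: "length a = l" "length a' = l" "length s = k - l" "l \<le> k"
      using s len by (auto simp: l_def)
    have reds: "reduced s" "reduced a" "reduced a'" using red s by (auto simp: reduced_append)
    define g where "g = prod_list (rev (map qcnj a) @ a')"
    have "hd a' \<noteq> qcnj (last (rev (map qcnj a)))" if "a \<noteq> []" "a' \<noteq> []"
      using that s(3) by (simp add: last_rev hd_map)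
    then have redg: "reduced (rev (map qcnj a) @ a')"
      using reds reduced_rev_qcnj by (auto simp: reduced_append)
    have ng: "qnrm g = 25 ^ l"
    proof -
      have "qnrm g = 5 ^ (l + l)"
        using qnrm_prod_list[of "rev (map qcnj a) @ a'"] redg la
        unfolding g_def by (simp add: reduced_def del: prod_list.append)
      also have "\<dots> = 25 ^ l" by (simp add: power_add flip: power_mult_distrib)
      finally show ?thesis .
    qed
    have na: "qnrm (prod_list a) = 5 ^ l" "qnrm (prod_list s) = 5 ^ (k - l)"
      using qnrm_prod_list reds la by (auto simp: reduced_def)
    \<comment> \<open>This turns closeness of \<open>a\<close> and \<open>a'\<close> into closeness
      of \<open>g\<close> to a scalar; the prefix \<open>s\<close> only multiplies the norm of the
      difference.\<close>
    have "g - qscalar (5 ^ l) = qcnj (prod_list a) * (prod_list a' - prod_list a)"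
      by (simp add: g_def prod_list_rev_qcnj right_diff_distrib qcnj_mult_self na)
    then have "qnrm (g - qscalar (5 ^ l)) = 5 ^ l * qnrm (prod_list a' - prod_list a)"
      by (simp add: qnrm_mult na)
    moreover have "prod_list u - prod_list v = prod_list s * (prod_list a - prod_list a')"
      using s by (simp add: right_diff_distrib)
    then have "qnrm (prod_list u - prod_list v) = 5 ^ (k - l) * qnrm (prod_list a' - prod_list a)"
      by (simp add: qnrm_mult na) (simp add: qnrm_def minus_quat_def power2_commute)
    then have "5 ^ (k - l) * real_of_int (qnrm (prod_list a' - prod_list a))
        \<le> 5 ^ (k - l) * (\<tau>\<^sup>2 * 5 ^ l)"
      using cl la(4) by (simp add: mult.left_commute flip: power_add)
    then have "real_of_int (qnrm (prod_list a' - prod_list a)) \<le> \<tau>\<^sup>2 * 5 ^ l" by simp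
    then have "5 ^ l * real_of_int (qnrm (prod_list a' - prod_list a)) \<le> 5 ^ l * (\<tau>\<^sup>2 * 5 ^ l)"
      by simp
    ultimately have "g \<in> near_scalar l \<tau>"
      using ng by (simp add: near_scalar_def power2_eq_square algebra_simps)
    then have "(l, s, g) \<in> D" using la reds by (auto simp: D_def rwords_def)
    moreover have "R p (l, s, g)" using s la redg by (auto simp: R_def uv g_def)
    ultimately show "\<exists>b. b \<in> D \<and> R p b" by blast
  next
    fix p q b assume R: "R p b" "R q b"
    obtain l s g where b: "b = (l, s, g)" by (cases b)
    obtain u v u' v' where pq: "p = (u, v)" "q = (u', v')" by (cases p; cases q)
    obtain a a' c c' where 1: "u = s @ a" "v = s @ a'" "length a = l" "length a' = l"
        "reduced (rev (map qcnj a) @ a')" "g = prod_list (rev (map qcnj a) @ a')"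
      and 2: "u' = s @ c" "v' = s @ c'" "length c = l" "length c' = l"
        "reduced (rev (map qcnj c) @ c')" "g = prod_list (rev (map qcnj c) @ c')"
      using R unfolding R_def b pq by auto
    \<comment> \<open>Both words are reduced of length \<open>l + l\<close> with product
      \<open>g\<close>, so they agree; cutting in the middle recovers the two halves.\<close>
    have "rev (map qcnj a) @ a' = rev (map qcnj c) @ c'"
      by (rule reduced_prod_inj) (use 1 2 in auto)
    then have e: "rev (map qcnj a) = rev (map qcnj c)" "a' = c'" using 1 2 by auto
    have "inj (qcnj :: int quat \<Rightarrow> int quat)" by (metis injI qcnj_qcnj)
    then have "a = c" using e by (simp add: inj_map_eq_map)
    then show "p = q" using e 1 2 pq by simp
  qed
  also have "card D = (\<Sum>l\<le>k. card (rwords (k - l)) * card (near_scalar l \<tau>))"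
    unfolding D_def using finite_near_scalar[OF assms]
    by (subst card_SigmaI) (auto simp: card_cartesian_product)
  finally show ?thesis .
qed

text \<open>The expected count: there are about \<open>5 ^ (6 * m)\<close> pairs, and a ball of
  radius of order \<open>1 / 5 ^ m\<close> fills a proportion of order
  \<open>1 / 5 ^ (3 * m)\<close> of the three-dimensional rotation group. The diagonal alone already
  has \<open>5 ^ (3 * m)\<close> pairs or more.\<close>

lemma close_pairs_bound:
  fixes \<epsilon> :: real
  assumes "\<epsilon> > 0"
  shows "\<exists>C\<ge>1. \<forall>m. real (card (close_pairs (3 * m) (3 / 5 ^ m))) \<le> C * 5 powr (real m * (3 + \<epsilon>))"
proof -
  \<comment> \<open>As \<open>25 ^ l\<close> is at most \<open>5 ^ (6 * m)\<close>, the exponent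
    \<open>\<epsilon> / 12\<close> costs half of the admissible loss. The other half, in
    \<open>K\<close>, covers the number \<open>3 * m + 1\<close> of summands.\<close>
  obtain C where C: "C \<ge> 1"
    "\<And>n X. n \<le> int X \<Longrightarrow> X \<ge> 1 \<Longrightarrow> real (card (two_squares n)) \<le> C * real X powr (\<epsilon> / 12)"
    using two_squares_bound_int[of "\<epsilon> / 12"] assms by auto
  obtain K where K: "K \<ge> 1" "\<And>a::nat. real a + 1 \<le> K * (5 powr (\<epsilon> / 2)) ^ a"
    using linear_le_exponential[of "5 powr (\<epsilon> / 2)"] assms by auto
  have "real (card (close_pairs (3 * m) (3 / 5 ^ m))) \<le> (234 * K * C) * 5 powr (real m * (3 + \<epsilon>))" for m
  proof -
    define \<tau> :: real where "\<tau> = 3 / 5 ^ m"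
    have \<tau>: "0 \<le> \<tau>" "\<tau> \<le> 3" by (auto simp: \<tau>_def field_simps)
    define M where "M = C * 5 powr (real m * (\<epsilon> / 2))"
    have M0: "M \<ge> 0" using C(1) by (simp add: M_def)
    have M: "real (card (two_squares n)) \<le> M" if "n \<le> 25 ^ l" "l \<le> 3 * m" for n l
    proof -
      have "n \<le> int (25 ^ l)" using that by simp
      then have "real (card (two_squares n)) \<le> C * real (25 ^ l) powr (\<epsilon> / 12)"
        by (rule C(2)) simp
      also have "real (25 ^ l) = 5 powr (real (2 * l))" by (simp add: powr_realpow power_mult del: of_nat_mult)
      also have "(5 powr (real (2 * l))) powr (\<epsilon> / 12) = 5 powr (real l * (\<epsilon> / 6))"
        by (simp add: powr_powr mult.commute)
      also have "\<dots> \<le> 5 powr (real m * (\<epsilon> / 2))"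
      proof -
        have "real l * (\<epsilon> / 6) \<le> real (3 * m) * (\<epsilon> / 6)"
          using that assms by (intro mult_right_mono) auto
        then show ?thesis by (simp add: field_simps)
      qed
      finally show ?thesis using C(1) by (simp add: M_def)
    qed
    have summand: "real (card (rwords (3 * m - l)) * card (near_scalar l \<tau>)) \<le> 78 * 125 ^ m * M"
      if l: "l \<le> 3 * m" for l
    proof -
      \<comment> \<open>With \<open>x = 5 ^ (3 * m - l)\<close> and \<open>y = 5 ^ l\<close>, the
        product \<open>x * y\<close> is \<open>125 ^ m\<close> for every \<open>l\<close>. In the
        bracket only \<open>\<tau> ^ 3 * y\<close> grows with \<open>l\<close>, and it stays at most
        27 exactly because the words have length \<open>3 * m\<close>.\<close>
      have expand: "(2 * x) * ((\<tau>\<^sup>2 * y / 2 + 1) * (2 * \<tau> * y + 1) * M)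
          = 2 * (x * y) * (\<tau> ^ 3 * y + \<tau>\<^sup>2 / 2 + 2 * \<tau>) * M + 2 * x * M" for x y
        by (simp add: power2_eq_square power3_eq_cube algebra_simps)
      have p1: "(5::real) ^ (3 * m - l) * 5 ^ l = 125 ^ m"
        using l by (simp add: power_mult flip: power_add)
      have "\<tau> ^ 3 * 5 ^ l \<le> \<tau> ^ 3 * 5 ^ (3 * m)"
        using l \<tau> by (intro mult_left_mono power_increasing) auto
      also have "\<dots> = 27" by (simp add: \<tau>_def power_divide power_mult[symmetric] mult.commute)
      finally have c1: "\<tau> ^ 3 * 5 ^ l \<le> 27" .
      have c2: "\<tau>\<^sup>2 \<le> 9" using \<tau> power_mono[of \<tau> 3 2] by simp
      have "real (card (rwords (3 * m - l)) * card (near_scalar l \<tau>))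
          = real (card (rwords (3 * m - l))) * real (card (near_scalar l \<tau>))" by simp
      also have "\<dots> \<le> (2 * 5 ^ (3 * m - l)) * ((\<tau>\<^sup>2 * 5 ^ l / 2 + 1) * (2 * \<tau> * 5 ^ l + 1) * M)"
      proof (rule mult_mono)
        show "real (card (rwords (3 * m - l))) \<le> 2 * 5 ^ (3 * m - l)"
          using of_nat_mono[OF card_rwords_bounds(2)[of "3 * m - l"], where 'a = real] by simp
        show "real (card (near_scalar l \<tau>)) \<le> (\<tau>\<^sup>2 * 5 ^ l / 2 + 1) * (2 * \<tau> * 5 ^ l + 1) * M"
          using card_near_scalar_le[OF \<tau>(1)] M l by blast
      qed auto
      also have "\<dots> = 2 * (5 ^ (3 * m - l) * 5 ^ l) * (\<tau> ^ 3 * 5 ^ l + \<tau>\<^sup>2 / 2 + 2 * \<tau>) * M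
          + 2 * 5 ^ (3 * m - l) * M"
        by (rule expand)
      also have "\<dots> \<le> 2 * 125 ^ m * 38 * M + 2 * 125 ^ m * M"
      proof (rule add_mono)
        show "2 * (5 ^ (3 * m - l) * 5 ^ l) * (\<tau> ^ 3 * 5 ^ l + \<tau>\<^sup>2 / 2 + 2 * \<tau>) * M \<le> 2 * 125 ^ m * 38 * M"
          unfolding p1 using c1 c2 \<tau> M0 by (intro mult_right_mono mult_left_mono) auto
        have "(5::real) ^ (3 * m - l) \<le> 5 ^ (3 * m)" by (intro power_increasing) auto
        then show "2 * 5 ^ (3 * m - l) * M \<le> 2 * 125 ^ m * M"
          using M0 by (intro mult_right_mono) (auto simp: power_mult)
      qed
      also have "\<dots> = 78 * 125 ^ m * M" by simp
      finally show ?thesis .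
    qed
    have "real (card (close_pairs (3 * m) \<tau>))
        \<le> real (\<Sum>l\<le>3 * m. card (rwords (3 * m - l)) * card (near_scalar l \<tau>))"
      using card_close_pairs_le[OF \<tau>(1)] of_nat_le_iff by blast
    also have "\<dots> = (\<Sum>l\<le>3 * m. real (card (rwords (3 * m - l)) * card (near_scalar l \<tau>)))" by simp
    also have "\<dots> \<le> (\<Sum>l\<le>3 * m. 78 * 125 ^ m * M)" by (intro sum_mono summand) auto
    also have "\<dots> = (3 * real m + 1) * (78 * 125 ^ m * M)" by simp
    also have "\<dots> \<le> (3 * (K * (5 powr (\<epsilon> / 2)) ^ m)) * (78 * 125 ^ m * M)"
      using K(2)[of m] M0 by (intro mult_right_mono) auto
    also have "\<dots> = (234 * K * C) * ((5 powr (\<epsilon> / 2)) ^ m * 125 ^ m * 5 powr (real m * (\<epsilon> / 2)))"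
      by (simp add: M_def)
    also have "(5 powr (\<epsilon> / 2)) ^ m * 125 ^ m * 5 powr (real m * (\<epsilon> / 2)) = 5 powr (real m * (3 + \<epsilon>))"
    proof -
      have "(125::real) ^ m = 5 powr (real m * 3)"
        by (simp add: powr_realpow[of 5 "m * 3", simplified] power_mult mult.commute[of m 3])
      moreover have "(5 powr (\<epsilon> / 2)) ^ m = 5 powr (real m * (\<epsilon> / 2))"
        by (simp add: powr_power mult.commute)
      ultimately show ?thesis by (simp add: algebra_simps add_divide_distrib flip: powr_add)
    qed
    finally show ?thesis by (simp add: \<tau>_def)
  qed
  moreover have "1 * 1 \<le> K * C" using K(1) C(1) by (intro mult_mono) auto
  then have "234 * K * C \<ge> 1" by simp
  ultimately show ?thesis by blast
qed

section \<open>Orbits on the 2-sphere\<close>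

lemma card_image_le_fibres:
  assumes "finite X" "\<And>y. y \<in> g ` X \<Longrightarrow> card (f ` {x \<in> X. g x = y}) \<le> K"
  shows "card (f ` X) \<le> card (g ` X) * K"
proof -
  have "f ` X = (\<Union>y\<in>g ` X. f ` {x \<in> X. g x = y})" by auto
  then have "card (f ` X) \<le> (\<Sum>y\<in>g ` X. card (f ` {x \<in> X. g x = y}))"
    using card_UN_le[of "g ` X" "\<lambda>y. f ` {x \<in> X. g x = y}"] assms(1) by simp
  also have "\<dots> \<le> (\<Sum>y\<in>g ` X. K)" by (intro sum_mono assms(2))
  finally show ?thesis by simp
qed

text \<open>Cauchy-Schwarz over the fibres of \<open>f\<close>: few collisions force many
  values.\<close>

lemma card_square_le_collisions:
  assumes "finite X"
  shows "(card X)\<^sup>2 \<le> card (f ` X) * card {(x, y). x \<in> X \<and> y \<in> X \<and> f x = f y}"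
proof -
  define c where "c = (\<lambda>z. card {x \<in> X. f x = z})"
  have X: "card X = (\<Sum>z\<in>f ` X. c z)"
    unfolding c_def using sum.image_gen[OF assms, of "\<lambda>_. 1::nat" f] by simp
  have "{(x, y). x \<in> X \<and> y \<in> X \<and> f x = f y} = (\<Union>z\<in>f ` X. {x \<in> X. f x = z} \<times> {x \<in> X. f x = z})"
    by auto
  also have "card \<dots> = (\<Sum>z\<in>f ` X. card ({x \<in> X. f x = z} \<times> {x \<in> X. f x = z}))"
    using assms by (intro card_UN_disjoint) auto
  finally have P: "card {(x, y). x \<in> X \<and> y \<in> X \<and> f x = f y} = (\<Sum>z\<in>f ` X. (c z)\<^sup>2)"
    by (simp add: c_def card_cartesian_product power2_eq_square)
  have "(real (card X))\<^sup>2 = (\<Sum>z\<in>f ` X. real (c z))\<^sup>2" unfolding X by simp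
  also have "\<dots> \<le> (\<Sum>z\<in>f ` X. (real (c z))\<^sup>2) * real (card (f ` X))"
    by (rule sum_squared_le_sum_of_squares)
  also have "\<dots> = real ((\<Sum>z\<in>f ` X. (c z)\<^sup>2) * card (f ` X))" by simp
  finally show ?thesis unfolding P by (metis mult.commute of_nat_le_iff of_nat_power)
qed

definition annulus :: "real \<Rightarrow> real \<Rightarrow> (int \<times> int) set" where
  "annulus S R = {(i, j). \<bar>real_of_int (i\<^sup>2 + j\<^sup>2) - S\<bar> \<le> R}"

lemma annulus_subset: "annulus S R \<subseteq> (\<Union>n\<in>{\<lceil>S - R\<rceil>..\<lfloor>S + R\<rfloor>}. two_squares n)"
proof
  fix z assume "z \<in> annulus S R"
  then obtain i j where z: "z = (i, j)" "\<bar>real_of_int (i\<^sup>2 + j\<^sup>2) - S\<bar> \<le> R" by (auto simp: annulus_def)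
  then have "i\<^sup>2 + j\<^sup>2 \<in> {\<lceil>S - R\<rceil>..\<lfloor>S + R\<rfloor>}"
    unfolding atLeastAtMost_iff ceiling_le_iff le_floor_iff by linarith
  then show "z \<in> (\<Union>n\<in>{\<lceil>S - R\<rceil>..\<lfloor>S + R\<rfloor>}. two_squares n)"
    using z by (auto simp: two_squares_def)
qed

lemma finite_annulus [simp]: "finite (annulus S R)"
  by (rule finite_subset[OF annulus_subset]) auto

text \<open>At most \<open>17 * 5 ^ m\<close> integers lie in the range, each with few
  representations. The width 8 allows 3 for rounding either coordinate
  (\<open>floor_square_diff\<close>) and 2 for the geometric error in \<open>sphere_cells\<close>
  and \<open>height_cells\<close>.\<close>

lemma annulus_bound:
  fixes \<epsilon> :: real
  assumes "\<epsilon> > 0"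
  shows "\<exists>C\<ge>1. \<forall>m S. S \<le> 25 ^ m \<longrightarrow>
    real (card (annulus S (8 * 5 ^ m))) \<le> C * 5 powr (real m * (1 + \<epsilon>))"
proof -
  obtain C where C: "C \<ge> 1"
    "\<And>n X. n \<le> int X \<Longrightarrow> X \<ge> 1 \<Longrightarrow> real (card (two_squares n)) \<le> C * real X powr (\<epsilon> / 2)"
    using two_squares_bound_int[of "\<epsilon> / 2"] assms by auto
  define K where "K = 17 * C * 9 powr (\<epsilon> / 2)"
  have "real (card (annulus S (8 * 5 ^ m))) \<le> K * 5 powr (real m * (1 + \<epsilon>))"
    if S: "S \<le> 25 ^ m" for m S
  proof -
    define R :: real where "R = 8 * 5 ^ m"
    define I where "I = {\<lceil>S - R\<rceil>..\<lfloor>S + R\<rfloor>}"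
    define M where "M = C * real (9 * 25 ^ m) powr (\<epsilon> / 2)"
    have R0: "R \<ge> 0" by (simp add: R_def)
    have "(5::real) ^ m \<le> 25 ^ m" by (intro power_mono) auto
    then have SR: "S + R \<le> 9 * 25 ^ m" using S by (simp add: R_def)
    have "card (annulus S R) \<le> card (\<Union>n\<in>I. two_squares n)"
      unfolding I_def by (intro card_mono annulus_subset) auto
    also have "\<dots> \<le> (\<Sum>n\<in>I. card (two_squares n))" by (intro card_UN_le) (simp add: I_def)
    finally have "real (card (annulus S R)) \<le> real (\<Sum>n\<in>I. card (two_squares n))" by (rule of_nat_mono)
    also have "\<dots> = (\<Sum>n\<in>I. real (card (two_squares n)))" by simp
    also have "\<dots> \<le> (\<Sum>n\<in>I. M)"
    proof (rule sum_mono)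
      fix n assume "n \<in> I"
      then have "real_of_int n \<le> S + R" by (simp add: I_def le_floor_iff)
      then have "real_of_int n \<le> real_of_int (9 * 25 ^ m)" using SR by simp
      then have "n \<le> int (9 * 25 ^ m)" unfolding of_int_le_iff by simp
      then show "real (card (two_squares n)) \<le> M" unfolding M_def by (rule C(2)) simp
    qed
    also have "\<dots> = real (card I) * M" by simp
    also have "\<dots> \<le> (2 * R + 1) * M"
    proof (rule mult_right_mono)
      show "real (card I) \<le> 2 * R + 1"
        unfolding I_def using R0 by (intro order_trans[OF card_int_interval_le]) auto
      show "0 \<le> M" using C(1) by (simp add: M_def)
    qed
    also have "\<dots> \<le> (17 * 5 ^ m) * M"
      using C(1) by (intro mult_right_mono) (auto simp: R_def M_def)
    also have "M = C * (9 powr (\<epsilon> / 2) * 5 powr (real m * \<epsilon>))"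
    proof -
      have "real (9 * 25 ^ m) powr (\<epsilon> / 2) = 9 powr (\<epsilon> / 2) * (25 ^ m) powr (\<epsilon> / 2)"
        by (simp add: powr_mult)
      also have "(25::real) ^ m = 5 powr (2 * real m)"
        by (simp add: power_mult powr_realpow[of 5 "2 * m", simplified])
      finally show ?thesis by (simp add: M_def powr_powr)
    qed
    also have "17 * 5 ^ m * (C * (9 powr (\<epsilon> / 2) * 5 powr (real m * \<epsilon>)))
        = K * (5 powr real m * 5 powr (real m * \<epsilon>))"
      by (simp add: K_def powr_realpow)
    also have "5 powr real m * 5 powr (real m * \<epsilon>) = 5 powr (real m * (1 + \<epsilon>))"
      by (simp add: algebra_simps flip: powr_add)
    finally show ?thesis by (simp add: R_def)
  qed
  moreover have "1 * 1 \<le> C * 9 powr (\<epsilon> / 2)"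
    using C(1) assms by (intro mult_mono ge_one_powr_ge_zero) auto
  then have "K \<ge> 1" by (simp add: K_def)
  ultimately show ?thesis by blast
qed

section \<open>Real quaternions acting on 3-space\<close>

definition rquat :: "int quat \<Rightarrow> real quat" where
  "rquat q = Quat (of_int (qre q)) (of_int (qi q)) (of_int (qj q)) (of_int (qk q))"

lemma rquat_mult: "rquat (p * q) = rquat p * rquat q"
  by (simp add: rquat_def times_quat_def)

lemma rquat_diff: "rquat (p - q) = rquat p - rquat q"
  by (simp add: rquat_def minus_quat_def)

lemma qnrm_rquat: "qnrm (rquat q) = of_int (qnrm q)"
  by (simp add: qnrm_def rquat_def)

text \<open>Conjugation by \<open>q\<close>, the inverse being \<open>qcnj q\<close> divided by
  \<open>qnrm q\<close>; for nonzero \<open>q\<close> it rotates the 3-space of quaternions with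
  real part 0.\<close>

definition qact :: "real quat \<Rightarrow> real quat \<Rightarrow> real quat" where
  "qact q v = qscalar (1 / qnrm q) * (q * v * qcnj q)"

lemma qre_qact: "qre v = 0 \<Longrightarrow> qre (qact q v) = 0"
  by (simp add: qact_def qscalar_mult times_quat_def qcnj_def algebra_simps)

lemma qmult_qcnj_self: "q * qcnj q = qscalar (qnrm q)"
  using qcnj_mult_self[of "qcnj q"] by simp

lemma qscalar_commute: "q * qscalar c = qscalar c * q"
  by (simp add: times_quat_def mult.commute)

lemma qscalar_assoc: "qscalar c * (qscalar d * q) = qscalar (c * d) * q"
  by (simp add: qscalar_mult mult.assoc)

lemma qnrm_qscalar: "qnrm (qscalar c) = c\<^sup>2"
  by (simp add: qnrm_def)

text \<open>The commutator is twice the cross product of the imaginary parts, and this is Lagrange's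
  identity for it.\<close>

lemma qnrm_commutator:
  fixes h v :: "real quat"
  assumes "qre v = 0"
  shows "qnrm (h * v - v * h) = 4 * (((qi h)\<^sup>2 + (qj h)\<^sup>2 + (qk h)\<^sup>2) * qnrm v
    - (qi h * qi v + qj h * qj v + qk h * qk v)\<^sup>2)"
  using assms
  by (simp add: qnrm_def minus_quat_def times_quat_def power2_eq_square algebra_simps)

text \<open>Since \<open>q = p * h\<close> and \<open>p\<close> acts isometrically, the distance
  between the two images of \<open>v\<close> is the distance by which \<open>h\<close> moves
  \<open>v\<close>. Multiplying by the unit \<open>h\<close> on the right turns this displacement
  into a commutator.\<close>

lemma qnrm_qact_diff:
  fixes p q v :: "real quat"
  assumes N: "qnrm p = N" "qnrm q = N" "N > 0"
  defines "h \<equiv> qscalar (1 / N) * (qcnj p * q)"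
  shows "qnrm h = 1" "qnrm (qact q v - qact p v) = qnrm (h * v - v * h)"
proof -
  show h1: "qnrm h = 1"
    using N by (simp add: h_def qnrm_qscalar qnrm_mult power2_eq_square)
  have "p * h = qscalar (1 / N) * (p * qcnj p * q)"
    unfolding h_def by (metis mult.assoc qscalar_commute)
  also have "\<dots> = q"
    using N by (simp add: qmult_qcnj_self qscalar_assoc) (simp add: qscalar_mult)
  finally have q: "q = p * h" by simp
  have "q * v * qcnj q - p * v * qcnj p = p * (h * v * qcnj h - v) * qcnj p"
    unfolding q by (simp add: qcnj_mult mult.assoc right_diff_distrib left_diff_distrib)
  then have "qact q v - qact p v = qscalar (1 / N) * (p * (h * v * qcnj h - v) * qcnj p)"
    unfolding qact_def N by (metis right_diff_distrib)
  then have "qnrm (qact q v - qact p v) = qnrm (h * v * qcnj h - v)"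
    using N by (simp add: qnrm_qscalar qnrm_mult power2_eq_square)
  also have "\<dots> = qnrm ((h * v * qcnj h - v) * h)" by (simp add: qnrm_mult h1)
  also have "(h * v * qcnj h - v) * h = h * v - v * h"
    by (simp add: left_diff_distrib mult.assoc qcnj_mult_self h1)
      (simp add: times_quat_def)
  finally show "qnrm (qact q v - qact p v) = qnrm (h * v - v * h)" .
qed

lemma floor_square_diff:
  fixes t s :: real
  assumes "\<bar>t\<bar> \<le> s" "s \<ge> 1"
  shows "\<bar>(of_int \<lfloor>t\<rfloor>)\<^sup>2 - t\<^sup>2\<bar> \<le> 3 * s"
proof -
  have fl: "of_int \<lfloor>t\<rfloor> \<le> t" "t < of_int \<lfloor>t\<rfloor> + 1" by linarith+
  have "(of_int \<lfloor>t\<rfloor>)\<^sup>2 - t\<^sup>2 = (of_int \<lfloor>t\<rfloor> - t) * (of_int \<lfloor>t\<rfloor> + t)"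
    by (simp add: power2_eq_square algebra_simps)
  then have "\<bar>(of_int \<lfloor>t\<rfloor>)\<^sup>2 - t\<^sup>2\<bar> = \<bar>of_int \<lfloor>t\<rfloor> - t\<bar> * \<bar>of_int \<lfloor>t\<rfloor> + t\<bar>"
    by (simp add: abs_mult)
  also have "\<dots> \<le> 1 * (3 * s)"
    using fl assms by (intro mult_mono) linarith+
  finally show ?thesis by simp
qed

lemma same_floor_close:
  fixes x y s :: real
  assumes "\<lfloor>x / s\<rfloor> = \<lfloor>y / s\<rfloor>" "s > 0"
  shows "(x - y)\<^sup>2 \<le> s\<^sup>2"
proof -
  have "\<bar>x / s - y / s\<bar> \<le> 1" using assms(1) by linarith
  then have "\<bar>x - y\<bar> \<le> s" using assms(2) by (simp add: abs_le_iff field_simps)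
  then show ?thesis using assms(2) by (metis abs_le_square_iff abs_of_pos)
qed

definition cell3 :: "real \<Rightarrow> real quat \<Rightarrow> int \<times> int \<times> int" where
  "cell3 \<rho> v = (\<lfloor>qi v / \<rho>\<rfloor>, \<lfloor>qj v / \<rho>\<rfloor>, \<lfloor>qk v / \<rho>\<rfloor>)"

definition inn3 :: "real quat \<Rightarrow> real quat \<Rightarrow> real" where
  "inn3 h v = qi h * qi v + qj h * qj v + qk h * qk v"

text \<open>For a unit vector \<open>v\<close>, the quaternion \<open>h\<close> splits into its real part, its component
  along \<open>v\<close> and a remainder; \<open>h\<close> almost fixes \<open>v\<close> iff the remainder is small.\<close>

definition split_cell :: "real \<Rightarrow> real quat \<Rightarrow> real quat \<Rightarrow> (int \<times> int) \<times> int \<times> int \<times> int" where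
  "split_cell s v h = ((\<lfloor>qre h / s\<rfloor>, \<lfloor>inn3 h v / s\<rfloor>),
    \<lfloor>(qi h - inn3 h v * qi v) / s\<rfloor>, \<lfloor>(qj h - inn3 h v * qj v) / s\<rfloor>,
    \<lfloor>(qk h - inn3 h v * qk v) / s\<rfloor>)"

lemma qnrm_split:
  assumes "qre v = 0" "qnrm v = 1"
  shows "qnrm h = (qre h)\<^sup>2 + (inn3 h v)\<^sup>2 + (qi h - inn3 h v * qi v)\<^sup>2
    + (qj h - inn3 h v * qj v)\<^sup>2 + (qk h - inn3 h v * qk v)\<^sup>2"
proof -
  define b where "b = inn3 h v"
  have v: "(qi v)\<^sup>2 + (qj v)\<^sup>2 + (qk v)\<^sup>2 = 1" using assms by (simp add: qnrm_def)
  have "(qi h - b * qi v)\<^sup>2 + (qj h - b * qj v)\<^sup>2 + (qk h - b * qk v)\<^sup>2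
      = (qi h)\<^sup>2 + (qj h)\<^sup>2 + (qk h)\<^sup>2 - 2 * b * inn3 h v + b\<^sup>2 * ((qi v)\<^sup>2 + (qj v)\<^sup>2 + (qk v)\<^sup>2)"
    by (simp add: inn3_def power2_eq_square algebra_simps)
  then show ?thesis unfolding v b_def by (simp add: qnrm_def power2_eq_square)
qed

lemma inn3_diff: "inn3 (g - h) v = inn3 g v - inn3 h v"
  by (simp add: inn3_def minus_quat_def algebra_simps)

text \<open>Five squares occur and not four, because the remainder orthogonal to \<open>v\<close> is
  recorded by all three of its coordinates.\<close>

lemma same_split_cell_close:
  assumes "qre v = 0" "qnrm v = 1" "s > 0" "split_cell s v g = split_cell s v h"
  shows "qnrm (g - h) \<le> 5 * s\<^sup>2"
proof -
  have "(qre g - qre h)\<^sup>2 \<le> s\<^sup>2" "(inn3 g v - inn3 h v)\<^sup>2 \<le> s\<^sup>2"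
    "((qi g - inn3 g v * qi v) - (qi h - inn3 h v * qi v))\<^sup>2 \<le> s\<^sup>2"
    "((qj g - inn3 g v * qj v) - (qj h - inn3 h v * qj v))\<^sup>2 \<le> s\<^sup>2"
    "((qk g - inn3 g v * qk v) - (qk h - inn3 h v * qk v))\<^sup>2 \<le> s\<^sup>2"
    using assms(3,4) unfolding split_cell_def by (auto intro!: same_floor_close)
  then show ?thesis
    unfolding qnrm_split[OF assms(1,2)] inn3_diff
    by (simp add: minus_quat_def algebra_simps)
qed

section \<open>Cells and heights met by an orbit on the sphere\<close>

definition chosen :: "('a \<Rightarrow> 'b) \<Rightarrow> 'a set \<Rightarrow> 'b \<Rightarrow> 'a" where
  "chosen g X y = (SOME x. x \<in> X \<and> g x = y)"

lemma chosen:
  assumes "x \<in> X"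
  shows "chosen g X (g x) \<in> X" "g (chosen g X (g x)) = g x"
  using someI[of "\<lambda>x'. x' \<in> X \<and> g x' = g x" x] assms by (auto simp: chosen_def)

text \<open>Let \<open>g\<close> be the cell of the image of \<open>v\<close> and refine it to
  \<open>f\<close> by the position of the word relative to a base word of the same cell. By
  Cauchy-Schwarz and \<open>close_pairs_bound\<close>, \<open>f\<close> takes about
  \<open>5 ^ (6 * m) / 5 ^ (3 * m)\<close> values. Relative positions almost fix \<open>v\<close>;
  the stabiliser of \<open>v\<close> is a circle, so a cell carries only about \<open>5 ^ m\<close>
  of them, which leaves \<open>5 ^ (2 * m)\<close> cells.\<close>

theorem sphere_cells:
  fixes \<eta> :: real
  assumes "\<eta> > 0"
  shows "\<exists>c>0. \<forall>m v \<rho>. qre v = 0 \<longrightarrow> qnrm v = 1 \<longrightarrow> 0 < \<rho> \<longrightarrow> \<rho> \<le> 1 / 5 ^ m \<longrightarrow>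
    c * 5 powr (real m * (2 - \<eta>)) \<le>
      real (card ((\<lambda>ws. cell3 \<rho> (qact (rquat (prod_list ws)) v)) ` rwords (3 * m)))"
proof -
  obtain C1 where C1: "C1 \<ge> 1" "\<And>m S. S \<le> 25 ^ m \<Longrightarrow>
      real (card (annulus S (8 * 5 ^ m))) \<le> C1 * 5 powr (real m * (1 + \<eta> / 2))"
    using annulus_bound[of "\<eta> / 2"] assms by auto
  obtain C2 where C2: "C2 \<ge> 1" "\<And>m. real (card (close_pairs (3 * m) (3 / 5 ^ m)))
      \<le> C2 * 5 powr (real m * (3 + \<eta> / 2))"
    using close_pairs_bound[of "\<eta> / 2"] assms by auto
  have "1 / (8 * C1 * C2) * 5 powr (real m * (2 - \<eta>)) \<le>
      real (card ((\<lambda>ws. cell3 \<rho> (qact (rquat (prod_list ws)) v)) ` rwords (3 * m)))"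
    if v: "qre v = 0" "qnrm v = 1" and \<rho>: "0 < \<rho>" "\<rho> \<le> 1 / 5 ^ m" for m v \<rho>
  proof -
    define W where "W = rwords (3 * m)"
    define N :: real where "N = 125 ^ m"
    define s :: real where "s = 1 / 5 ^ m"
    have N0: "N > 0" and s0: "s > 0" "1 / s = 5 ^ m" "s \<le> 1"
      by (auto simp: N_def s_def)
    define P where "P = (\<lambda>ws. rquat (prod_list ws))"
    define g where "g = (\<lambda>ws. cell3 \<rho> (qact (P ws) v))"
    \<comment> \<open>The unit quaternion leading from the base word of the fibre to
      \<open>ws\<close>; as both send \<open>v\<close> to the same cell, it almost fixes
      \<open>v\<close>.\<close>
    define h where "h = (\<lambda>ws. qscalar (1 / N) * (qcnj (P (chosen g W (g ws))) * P ws))"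
    define f where "f = (\<lambda>ws. (g ws, split_cell s v (h ws)))"
    have nP: "qnrm (P ws) = N" if "ws \<in> W" for ws
      using that qnrm_prod_list[of ws]
      by (simp add: W_def rwords_def P_def qnrm_rquat N_def power_mult reduced_def)
    have finW: "finite W" by (simp add: W_def)

    \<comment> \<open>Words with equal \<open>f\<close> share their base word, so closeness of the
      relative positions is closeness of the words themselves. The constant 3 is a convenient root
      above \<open>sqrt 5\<close>.\<close>
    have "{(x, y). x \<in> W \<and> y \<in> W \<and> f x = f y} \<subseteq> close_pairs (3 * m) (3 / 5 ^ m)"
    proof safe
      fix x y assume xy: "x \<in> W" "y \<in> W" "f x = f y"
      define w where "w = chosen g W (g x)"
      have w: "w \<in> W" using chosen(1)[OF xy(1)] by (simp add: w_def)
      have gg: "g x = g y" and sc: "split_cell s v (h x) = split_cell s v (h y)"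
        using xy(3) by (auto simp: f_def)
      have "h x - h y = qscalar (1 / N) * (qcnj (P w) * (P x - P y))"
        unfolding h_def w_def gg by (simp add: right_diff_distrib)
      then have "qnrm (h x - h y) = (1 / N)\<^sup>2 * (N * qnrm (P x - P y))"
        by (simp only: qnrm_mult qnrm_qscalar qnrm_qcnj nP[OF w])
      then have "qnrm (P x - P y) = N * qnrm (h x - h y)"
        using N0 by (simp add: power2_eq_square)
      also have "\<dots> \<le> N * (9 * s\<^sup>2)"
        using same_split_cell_close[OF v s0(1) sc] N0 zero_le_power2[of s]
        by (intro mult_left_mono) linarith+
      also have "\<dots> = (3 / 5 ^ m)\<^sup>2 * 5 ^ (3 * m)"
        by (simp add: s_def N_def power_divide power_mult)
      finally show "(x, y) \<in> close_pairs (3 * m) (3 / 5 ^ m)"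
        using xy by (simp add: close_pairs_def W_def P_def qnrm_rquat flip: rquat_diff)
    qed
    then have "card {(x, y). x \<in> W \<and> y \<in> W \<and> f x = f y} \<le> card (close_pairs (3 * m) (3 / 5 ^ m))"
      by (intro card_mono) auto
    then have coll: "real (card {(x, y). x \<in> W \<and> y \<in> W \<and> f x = f y})
        \<le> C2 * 5 powr (real m * (3 + \<eta> / 2))"
      using C2(2)[of m] by linarith

    \<comment> \<open>Real part and component along \<open>v\<close> lie near the unit circle, hence
      their rounded multiples in an annulus of radius \<open>5 ^ m\<close>; the remainder is shorter
      than \<open>s\<close>, so its rounded coordinates are -1 or 0.\<close>
    let ?T = "annulus (25 ^ m) (8 * 5 ^ m) \<times> {- 1, 0::int} \<times> {- 1, 0::int} \<times> {- 1, 0::int}"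
    have T: "split_cell s v (h x) \<in> ?T" if x: "x \<in> W" for x
    proof -
      define w where "w = chosen g W (g x)"
      have w: "w \<in> W" "g w = g x" using chosen[OF x, of g] by (simp_all add: w_def)
      define a where "a = qre (h x)"
      define b where "b = inn3 (h x) v"
      define p1 p2 p3 where "p1 = qi (h x) - b * qi v" and "p2 = qj (h x) - b * qj v"
        and "p3 = qk (h x) - b * qk v"
      have hx: "h x = qscalar (1 / N) * (qcnj (P w) * P x)" by (simp add: h_def w_def)
      note geom = qnrm_qact_diff[OF nP[OF w(1)] nP[OF x] N0, folded hx]
      have "(qi (qact (P x) v) - qi (qact (P w) v))\<^sup>2 \<le> \<rho>\<^sup>2"
        "(qj (qact (P x) v) - qj (qact (P w) v))\<^sup>2 \<le> \<rho>\<^sup>2"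
        "(qk (qact (P x) v) - qk (qact (P w) v))\<^sup>2 \<le> \<rho>\<^sup>2"
        using w(2) \<rho>(1) unfolding g_def cell3_def by (auto intro!: same_floor_close)
      moreover have "qnrm (qact (P x) v - qact (P w) v) =
          (qi (qact (P x) v) - qi (qact (P w) v))\<^sup>2 + (qj (qact (P x) v) - qj (qact (P w) v))\<^sup>2
          + (qk (qact (P x) v) - qk (qact (P w) v))\<^sup>2"
        by (simp add: qnrm_def minus_quat_def qre_qact[OF v(1)])
      moreover have "\<rho>\<^sup>2 \<le> s\<^sup>2" using \<rho> by (intro power_mono) (auto simp: s_def)
      ultimately have "qnrm (h x * v - v * h x) \<le> 3 * s\<^sup>2" using geom(2)[of v] by linarith
      moreover have "qnrm (h x * v - v * h x) = 4 * ((qi (h x))\<^sup>2 + (qj (h x))\<^sup>2 + (qk (h x))\<^sup>2 - b\<^sup>2)"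
        using qnrm_commutator[OF v(1), of "h x"] v(2) by (simp add: b_def inn3_def)
      moreover have split: "1 = a\<^sup>2 + b\<^sup>2 + p1\<^sup>2 + p2\<^sup>2 + p3\<^sup>2"
        using qnrm_split[OF v, of "h x"] geom(1) by (simp add: a_def b_def p1_def p2_def p3_def)
      moreover have "1 = a\<^sup>2 + ((qi (h x))\<^sup>2 + (qj (h x))\<^sup>2 + (qk (h x))\<^sup>2)"
        using geom(1) by (simp add: qnrm_def a_def)
      ultimately have perp: "p1\<^sup>2 + p2\<^sup>2 + p3\<^sup>2 \<le> 3 / 4 * s\<^sup>2" by argo
      have "s\<^sup>2 > 0" using s0 by simp
      \<comment> \<open>The factor 4 in the commutator identity is what brings the bound
        \<open>3 * s\<^sup>2\<close> strictly below \<open>s\<^sup>2\<close>.\<close>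
      have small: "\<lfloor>p / s\<rfloor> \<in> {-1, 0}" if "p\<^sup>2 \<le> 3 / 4 * s\<^sup>2" for p
      proof -
        have "p\<^sup>2 < s\<^sup>2" using that \<open>s\<^sup>2 > 0\<close> by linarith
        then have "\<bar>p\<bar> < s" using s0 by (metis abs_of_pos power2_less_imp_less abs_ge_zero power2_abs less_imp_le)
        then have "-1 < p / s" "p / s < 1" using s0 by (auto simp: field_simps abs_less_iff)
        then show ?thesis by (auto simp: floor_eq_iff)
      qed
      have p: "\<lfloor>p1 / s\<rfloor> \<in> {-1, 0}" "\<lfloor>p2 / s\<rfloor> \<in> {-1, 0}" "\<lfloor>p3 / s\<rfloor> \<in> {-1, 0}"
        using perp zero_le_power2[of p1] zero_le_power2[of p2] zero_le_power2[of p3]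
        by (intro small; linarith)+
      define i j where "i = \<lfloor>a / s\<rfloor>" and "j = \<lfloor>b / s\<rfloor>"
      have "a\<^sup>2 \<le> 1\<^sup>2" "b\<^sup>2 \<le> 1\<^sup>2"
        using split zero_le_power2[of p1] zero_le_power2[of p2] zero_le_power2[of p3]
          zero_le_power2[of a] zero_le_power2[of b] unfolding one_power2 by linarith+
      then have "\<bar>a\<bar> \<le> 1" "\<bar>b\<bar> \<le> 1" by (simp_all only: abs_le_square_iff abs_one flip: abs_le_square_iff)
      then have "\<bar>a / s\<bar> \<le> 1 / s" "\<bar>b / s\<bar> \<le> 1 / s"
        using s0(1) by (simp_all add: abs_divide divide_right_mono)
      then have ij: "\<bar>(of_int i)\<^sup>2 - (a / s)\<^sup>2\<bar> \<le> 3 * (1 / s)" "\<bar>(of_int j)\<^sup>2 - (b / s)\<^sup>2\<bar> \<le> 3 * (1 / s)"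
        unfolding i_def j_def using s0 by (auto intro!: floor_square_diff simp del: times_divide_eq_right)
      have "(1 / s)\<^sup>2 * (p1\<^sup>2 + p2\<^sup>2 + p3\<^sup>2) \<le> (1 / s)\<^sup>2 * (3 / 4 * s\<^sup>2)"
        using perp by (intro mult_left_mono) auto
      also have "\<dots> = 3 / 4" using s0(1) by (simp add: power_divide)
      finally have q1: "(1 / s)\<^sup>2 * (p1\<^sup>2 + p2\<^sup>2 + p3\<^sup>2) \<le> 3 / 4" .
      have q0: "0 \<le> (1 / s)\<^sup>2 * (p1\<^sup>2 + p2\<^sup>2 + p3\<^sup>2)" by simp
      have "(a / s)\<^sup>2 + (b / s)\<^sup>2 = (1 / s)\<^sup>2 * (a\<^sup>2 + b\<^sup>2)"
        by (simp add: power_divide algebra_simps)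
      also have "a\<^sup>2 + b\<^sup>2 = 1 - (p1\<^sup>2 + p2\<^sup>2 + p3\<^sup>2)" using split by linarith
      also have "(1 / s)\<^sup>2 * (1 - (p1\<^sup>2 + p2\<^sup>2 + p3\<^sup>2)) = (1 / s)\<^sup>2 - (1 / s)\<^sup>2 * (p1\<^sup>2 + p2\<^sup>2 + p3\<^sup>2)"
        by (simp only: right_diff_distrib mult_1_right)
      also have "(1 / s)\<^sup>2 = 25 ^ m" unfolding s0(2) by (simp add: power2_eq_square flip: power_mult_distrib)
      finally have ab: "(a / s)\<^sup>2 + (b / s)\<^sup>2 \<le> 25 ^ m" "25 ^ m - 1 \<le> (a / s)\<^sup>2 + (b / s)\<^sup>2"
        using q0 q1 \<open>(1 / s)\<^sup>2 = 25 ^ m\<close> by simp_all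
      have "1 / s \<ge> 1" using s0 by simp
      then have "(i, j) \<in> annulus (25 ^ m) (8 * 5 ^ m)"
        using ij ab unfolding annulus_def mem_Collect_eq prod.case of_int_add of_int_power s0(2)[symmetric]
        by linarith
      moreover have "split_cell s v (h x) = ((i, j), \<lfloor>p1 / s\<rfloor>, \<lfloor>p2 / s\<rfloor>, \<lfloor>p3 / s\<rfloor>)"
        by (simp add: split_cell_def i_def j_def a_def b_def p1_def p2_def p3_def)
      ultimately show ?thesis using p by (simp only: mem_Sigma_iff simp_thms)
    qed
    have "card (f ` {x \<in> W. g x = y}) \<le> card ?T" for y
    proof -
      have "f ` {x \<in> W. g x = y} \<subseteq> (\<lambda>t. (y, t)) ` ?T"
      proof (rule image_subsetI)
        fix x assume "x \<in> {x \<in> W. g x = y}"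
        then have "x \<in> W" "g x = y" by blast+
        then show "f x \<in> (\<lambda>t. (y, t)) ` ?T"
          using imageI[OF T, of x "\<lambda>t. (y, t)"] by (simp only: f_def)
      qed
      then have "card (f ` {x \<in> W. g x = y}) \<le> card ((\<lambda>t. (y, t)) ` ?T)" by (intro card_mono) auto
      also have "\<dots> \<le> card ?T" by (rule card_image_le) simp
      finally show ?thesis .
    qed
    then have "card (f ` W) \<le> card (g ` W) * card ?T" by (intro card_image_le_fibres finW)
    also have "card ?T = 8 * card (annulus (25 ^ m) (8 * 5 ^ m))" by (simp add: card_cartesian_product)
    finally have "real (card (f ` W)) \<le> real (card (g ` W) * (8 * card (annulus (25 ^ m) (8 * 5 ^ m))))"
      by (rule of_nat_mono)
    also have "\<dots> = real (card (g ` W)) * (8 * real (card (annulus (25 ^ m) (8 * 5 ^ m))))" by simp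
    also have "\<dots> \<le> real (card (g ` W)) * (8 * (C1 * 5 powr (real m * (1 + \<eta> / 2))))"
      using C1(2)[of "25 ^ m" m] by (intro mult_left_mono) auto
    finally have fW: "real (card (f ` W)) \<le> real (card (g ` W)) * (8 * (C1 * 5 powr (real m * (1 + \<eta> / 2))))" .

    have "(5 ^ (3 * m))\<^sup>2 \<le> (card W)\<^sup>2"
      unfolding W_def by (intro power_mono card_rwords_bounds) auto
    also have "\<dots> \<le> card (f ` W) * card {(x, y). x \<in> W \<and> y \<in> W \<and> f x = f y}"
      by (rule card_square_le_collisions[OF finW])
    finally have "real ((5 ^ (3 * m))\<^sup>2) \<le> real (card (f ` W) * card {(x, y). x \<in> W \<and> y \<in> W \<and> f x = f y})"
      by (rule of_nat_mono)
    also have "\<dots> = real (card (f ` W)) * real (card {(x, y). x \<in> W \<and> y \<in> W \<and> f x = f y})" by simp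
    also have "\<dots> \<le> (real (card (g ` W)) * (8 * (C1 * 5 powr (real m * (1 + \<eta> / 2)))))
        * (C2 * 5 powr (real m * (3 + \<eta> / 2)))"
      using C1(1) by (intro mult_mono fW coll) auto
    also have "\<dots> = real (card (g ` W)) * (8 * C1 * C2) *
        (5 powr (real m * (1 + \<eta> / 2)) * 5 powr (real m * (3 + \<eta> / 2)))" by simp
    also have "5 powr (real m * (1 + \<eta> / 2)) * 5 powr (real m * (3 + \<eta> / 2)) = 5 powr (real m * (4 + \<eta>))"
      by (simp add: algebra_simps flip: powr_add)
    also have "real ((5 ^ (3 * m))\<^sup>2) = 5 powr (real m * (2 - \<eta>)) * 5 powr (real m * (4 + \<eta>))"
    proof -
      have "real ((5 ^ (3 * m))\<^sup>2) = 5 ^ (3 * m * 2)" by (simp only: power_mult) simp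
      also have "\<dots> = 5 powr real (3 * m * 2)" by (subst powr_realpow) auto
      finally show ?thesis by (simp add: algebra_simps flip: powr_add)
    qed
    finally have "5 powr (real m * (2 - \<eta>)) \<le> real (card (g ` W)) * (8 * C1 * C2)" by simp
    moreover have "8 * C1 * C2 > 0" using C1(1) C2(1) by simp
    ultimately show ?thesis by (simp add: g_def W_def P_def field_simps)
  qed
  moreover have "1 / (8 * C1 * C2) > 0" using C1(1) C2(1) by simp
  ultimately show ?thesis by blast
qed

text \<open>A band of the sphere between two parallel planes projects into an annulus.\<close>

theorem height_cells:
  fixes \<eta> :: real
  assumes "\<eta> > 0"
  shows "\<exists>c>0. \<forall>m v \<rho>. qre v = 0 \<longrightarrow> qnrm v = 1 \<longrightarrow> 0 < \<rho> \<longrightarrow> \<rho> \<le> 1 / 5 ^ m \<longrightarrow>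
    c * 5 powr (real m * (1 - \<eta>)) \<le>
      real (card ((\<lambda>ws. \<lfloor>qk (qact (rquat (prod_list ws)) v) / \<rho>\<rfloor>) ` rwords (3 * m)))"
proof -
  obtain C1 where C1: "C1 \<ge> 1" "\<And>m S. S \<le> 25 ^ m \<Longrightarrow>
      real (card (annulus S (8 * 5 ^ m))) \<le> C1 * 5 powr (real m * (1 + \<eta> / 2))"
    using annulus_bound[of "\<eta> / 2"] assms by auto
  obtain c where "c > 0" and cells: "\<And>m v \<rho>. qre v = 0 \<Longrightarrow> qnrm v = 1 \<Longrightarrow> 0 < \<rho> \<Longrightarrow> \<rho> \<le> 1 / 5 ^ m \<Longrightarrow>
    c * 5 powr (real m * (2 - \<eta> / 2)) \<le>
      real (card ((\<lambda>ws. cell3 \<rho> (qact (rquat (prod_list ws)) v)) ` rwords (3 * m)))"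
    using sphere_cells[of "\<eta> / 2"] assms by auto
  have "c / (3 * C1) * 5 powr (real m * (1 - \<eta>)) \<le>
      real (card ((\<lambda>ws. \<lfloor>qk (qact (rquat (prod_list ws)) v) / \<rho>\<rfloor>) ` rwords (3 * m)))"
    if v: "qre v = 0" "qnrm v = 1" and \<rho>: "0 < \<rho>" "\<rho> \<le> 1 / 5 ^ m" for m v \<rho>
  proof -
    define W where "W = rwords (3 * m)"
    define s :: real where "s = 1 / 5 ^ m"
    have s0: "s > 0" "1 / s = 5 ^ m" "s \<le> 1" by (auto simp: s_def)
    define X where "X = (\<lambda>ws. qact (rquat (prod_list ws)) v)"
    define g where "g = (\<lambda>ws. \<lfloor>qk (X ws) / \<rho>\<rfloor>)"
    \<comment> \<open>Sphere cells are counted at scale \<open>s = 1 / 5 ^ m\<close>, only heights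
      at the possibly finer \<open>\<rho>\<close>. A band of one height cell then meets at most
      three layers of sphere cells.\<close>
    define f where "f = (\<lambda>ws. cell3 s (X ws))"
    have finW: "finite W" by (simp add: W_def)
    have nX: "(qi (X x))\<^sup>2 + (qj (X x))\<^sup>2 + (qk (X x))\<^sup>2 = 1" if "x \<in> W" for x
    proof -
      have "qnrm (rquat (prod_list x)) \<noteq> 0"
        using that qnrm_prod_list[of x] by (simp add: W_def rwords_def qnrm_rquat reduced_def)
      then have "qnrm (X x) = 1"
        by (simp add: X_def qact_def qnrm_mult qnrm_qscalar v power2_eq_square)
      then show ?thesis using qre_qact[OF v(1)] by (simp add: qnrm_def X_def)
    qed
    \<comment> \<open>The first two coordinates satisfy
      \<open>a\<^sup>2 + b\<^sup>2 = 1 - z'\<^sup>2\<close>, which differs from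
      \<open>1 - z\<^sup>2\<close> by at most \<open>2 * s\<close>. So their rounded multiples lie
      in one annulus for the whole band.\<close>
    have fib: "card (f ` {x \<in> W. g x = y}) * 1 \<le> 3 * card (annulus ((1 - (qk (X w))\<^sup>2) * 25 ^ m) (8 * 5 ^ m))"
      if w: "w \<in> W" "g w = y" for y w
    proof -
      define z where "z = qk (X w)"
      let ?A = "annulus ((1 - z\<^sup>2) * 25 ^ m) (8 * 5 ^ m)"
      have "f ` {x \<in> W. g x = y} \<subseteq> (\<lambda>((i, j), k). (i, j, k)) ` (?A \<times> {\<lfloor>z / s\<rfloor> - 1..\<lfloor>z / s\<rfloor> + 1})"
      proof
        fix t assume "t \<in> f ` {x \<in> W. g x = y}"
        then obtain x where x: "x \<in> W" "g x = y" "t = f x" by auto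
        define z' where "z' = qk (X x)"
        define a b where "a = qi (X x)" and "b = qj (X x)"
        define i j where "i = \<lfloor>a / s\<rfloor>" and "j = \<lfloor>b / s\<rfloor>"
        have ab: "a\<^sup>2 + b\<^sup>2 + z'\<^sup>2 = 1" using nX[OF x(1)] by (simp add: a_def b_def z'_def)
        have z1: "z\<^sup>2 \<le> 1"
          using nX[OF w(1)] zero_le_power2[of "qi (X w)"] zero_le_power2[of "qj (X w)"]
          unfolding z_def by linarith
        have "\<bar>z' / \<rho> - z / \<rho>\<bar> \<le> 1" using x(2) w(2) unfolding g_def z_def z'_def by linarith
        then have "\<bar>z' - z\<bar> \<le> \<rho>" using \<rho>(1) by (simp add: abs_le_iff field_simps)
        then have zz: "\<bar>z' - z\<bar> \<le> s" using \<rho>(2) by (simp add: s_def)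
        have "a\<^sup>2 \<le> 1\<^sup>2" "b\<^sup>2 \<le> 1\<^sup>2" "z'\<^sup>2 \<le> 1\<^sup>2"
          using ab zero_le_power2[of a] zero_le_power2[of b] zero_le_power2[of z']
          unfolding one_power2 by linarith+
        then have le1: "\<bar>a\<bar> \<le> 1" "\<bar>b\<bar> \<le> 1" "\<bar>z'\<bar> \<le> 1" "\<bar>z\<bar> \<le> 1"
          using z1 by (simp_all add: abs_square_le_1)
        then have "\<bar>a / s\<bar> \<le> 1 / s" "\<bar>b / s\<bar> \<le> 1 / s"
          using s0(1) by (simp_all add: abs_divide divide_right_mono)
        then have ij: "\<bar>(of_int i)\<^sup>2 - (a / s)\<^sup>2\<bar> \<le> 3 * (1 / s)" "\<bar>(of_int j)\<^sup>2 - (b / s)\<^sup>2\<bar> \<le> 3 * (1 / s)"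
          unfolding i_def j_def using s0 by (auto intro!: floor_square_diff simp del: times_divide_eq_right)
        have s2: "(1 / s)\<^sup>2 = 25 ^ m" unfolding s0(2) by (simp add: power2_eq_square flip: power_mult_distrib)
        have "(a / s)\<^sup>2 + (b / s)\<^sup>2 - (1 - z\<^sup>2) * (1 / s)\<^sup>2 = (a\<^sup>2 + b\<^sup>2 - (1 - z\<^sup>2)) * (1 / s)\<^sup>2"
          by (simp add: power_divide algebra_simps add_divide_distrib diff_divide_distrib)
        also have "a\<^sup>2 + b\<^sup>2 - (1 - z\<^sup>2) = (z - z') * (z + z')"
          using ab by (simp add: power2_eq_square algebra_simps)
        finally have "\<bar>(a / s)\<^sup>2 + (b / s)\<^sup>2 - (1 - z\<^sup>2) * (1 / s)\<^sup>2\<bar> = \<bar>z' - z\<bar> * \<bar>z + z'\<bar> * (1 / s)\<^sup>2"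
          by (simp add: abs_mult abs_minus_commute)
        also have "\<dots> \<le> (s * 2) * (1 / s)\<^sup>2"
          using zz le1 s0(1) by (intro mult_right_mono mult_mono) auto
        also have "\<dots> = 2 * (1 / s)" using s0(1) by (simp add: power2_eq_square)
        finally have "(i, j) \<in> ?A"
          using ij unfolding annulus_def mem_Collect_eq prod.case of_int_add of_int_power
            s0(2)[symmetric] s2[symmetric]
          by linarith
        moreover have "\<bar>z' / s - z / s\<bar> \<le> 1"
          using zz s0(1) by (simp add: abs_le_iff field_simps)
        then have "\<lfloor>z' / s\<rfloor> \<in> {\<lfloor>z / s\<rfloor> - 1..\<lfloor>z / s\<rfloor> + 1}"
          unfolding atLeastAtMost_iff by linarith
        moreover have "t = (i, j, \<lfloor>z' / s\<rfloor>)"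
          by (simp add: x(3) f_def cell3_def i_def j_def a_def b_def z'_def)
        ultimately show "t \<in> (\<lambda>((i, j), k). (i, j, k)) ` (?A \<times> {\<lfloor>z / s\<rfloor> - 1..\<lfloor>z / s\<rfloor> + 1})"
          by force
      qed
      then have "card (f ` {x \<in> W. g x = y}) \<le> card (?A \<times> {\<lfloor>z / s\<rfloor> - 1..\<lfloor>z / s\<rfloor> + 1})"
        by (rule surj_card_le[rotated]) simp
      then show ?thesis by (simp add: card_cartesian_product z_def mult.commute)
    qed
    define K where "K = nat \<lfloor>3 * (C1 * 5 powr (real m * (1 + \<eta> / 2)))\<rfloor>"
    have "card (f ` {x \<in> W. g x = y}) \<le> K" if y: "y \<in> g ` W" for y
    proof -
      obtain w where w: "w \<in> W" "g w = y" using y by auto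
      have "(1 - (qk (X w))\<^sup>2) * 25 ^ m \<le> 25 ^ m" by (simp add: algebra_simps)
      note C1(2)[OF this]
      moreover have "real (card (f ` {x \<in> W. g x = y})) \<le>
          real (3 * card (annulus ((1 - (qk (X w))\<^sup>2) * 25 ^ m) (8 * 5 ^ m)))"
        using fib[OF w] by (intro of_nat_mono) simp
      ultimately have "real (card (f ` {x \<in> W. g x = y})) \<le> 3 * (C1 * 5 powr (real m * (1 + \<eta> / 2)))"
        by simp
      then show ?thesis unfolding K_def by (simp add: le_nat_floor)
    qed
    then have "card (f ` W) \<le> card (g ` W) * K" by (intro card_image_le_fibres finW)
    then have "real (card (f ` W)) \<le> real (card (g ` W) * K)" by (rule of_nat_mono)
    also have "\<dots> \<le> real (card (g ` W)) * (3 * (C1 * 5 powr (real m * (1 + \<eta> / 2))))"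
      unfolding of_nat_mult K_def using C1(1) by (intro mult_left_mono of_nat_floor) auto
    finally have "c * 5 powr (real m * (2 - \<eta> / 2)) \<le>
        real (card (g ` W)) * (3 * C1) * 5 powr (real m * (1 + \<eta> / 2))"
      using cells[OF v, of s m] s0(1) unfolding f_def X_def W_def by (simp add: s_def)
    moreover have "5 powr (real m * (2 - \<eta> / 2)) = 5 powr (real m * (1 - \<eta>)) * 5 powr (real m * (1 + \<eta> / 2))"
      by (simp add: algebra_simps flip: powr_add)
    ultimately have "c * 5 powr (real m * (1 - \<eta>)) \<le> real (card (g ` W)) * (3 * C1)"
      by (simp flip: mult.assoc)
    then show ?thesis using C1(1) by (simp add: g_def X_def W_def field_simps)
  qed
  moreover have "c / (3 * C1) > 0" using C1(1) \<open>c > 0\<close> by simp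
  ultimately show ?thesis by blast
qed

section \<open>Orbits in higher dimensions\<close>

lemma qact_scale: "qact q (qscalar t * v) = qscalar t * qact q v"
  by (simp add: qact_def times_quat_def qcnj_def algebra_simps)

lemma qact_mult:
  shows "qact (p * q) v = qact p (qact q v)"
proof -
  have "qact p (qact q v) = qscalar (1 / qnrm p) * (p * (qscalar (1 / qnrm q) * (q * v * qcnj q)) * qcnj p)"
    by (simp add: qact_def)
  also have "p * (qscalar (1 / qnrm q) * (q * v * qcnj q)) = qscalar (1 / qnrm q) * (p * (q * v * qcnj q))"
    by (metis mult.assoc qscalar_commute)
  finally show ?thesis
    by (simp only: qact_def qcnj_mult mult.assoc qscalar_assoc qnrm_mult) (simp add: qscalar_mult)
qed

lemma qact_one [simp]: "qact 1 v = v"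
  by (simp add: qact_def) (simp add: qscalar_mult)

lemma qnrm_qact: "qnrm q \<noteq> 0 \<Longrightarrow> qnrm (qact q v) = qnrm v"
  by (simp add: qact_def qnrm_mult qnrm_qscalar power2_eq_square)

lemma scaled_unit:
  assumes "qre v = 0" "qnrm v > 0"
  obtains u where "qre u = 0" "qnrm u = 1" "v = qscalar (sqrt (qnrm v)) * u"
proof
  define r where "r = sqrt (qnrm v)"
  have r: "r > 0" "r\<^sup>2 = qnrm v" using assms(2) by (auto simp: r_def)
  let ?u = "qscalar (1 / r) * v"
  show "qre ?u = 0" using assms(1) by (simp add: qscalar_mult)
  show "qnrm ?u = 1" using r assms(2) by (simp add: qnrm_mult qnrm_qscalar power_divide)
  show "v = qscalar (sqrt (qnrm v)) * ?u"
    using r(1) unfolding r_def[symmetric] qscalar_assoc by (simp add: qscalar_mult)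
qed

text \<open>Scaling vector and mesh together leaves the cells unchanged. The hypothesis on
  \<open>\<rho>\<close> also forces \<open>v\<close> to be nonzero.\<close>

lemma sphere_cells_scaled:
  fixes \<eta> :: real
  assumes "\<eta> > 0"
  shows "\<exists>c>0. \<forall>m v \<rho>. qre v = 0 \<longrightarrow> 0 < \<rho> \<longrightarrow> \<rho> * 5 ^ m \<le> sqrt (qnrm v) \<longrightarrow>
    c * 5 powr (real m * (2 - \<eta>)) \<le>
      real (card ((\<lambda>ws. cell3 \<rho> (qact (rquat (prod_list ws)) v)) ` rwords (3 * m)))"
proof -
  obtain c where c: "c > 0" "\<And>m v \<rho>. qre v = 0 \<Longrightarrow> qnrm v = 1 \<Longrightarrow> 0 < \<rho> \<Longrightarrow> \<rho> \<le> 1 / 5 ^ m \<Longrightarrow>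
    c * 5 powr (real m * (2 - \<eta>)) \<le>
      real (card ((\<lambda>ws. cell3 \<rho> (qact (rquat (prod_list ws)) v)) ` rwords (3 * m)))"
    using sphere_cells[OF assms] by auto
  have "c * 5 powr (real m * (2 - \<eta>)) \<le>
      real (card ((\<lambda>ws. cell3 \<rho> (qact (rquat (prod_list ws)) v)) ` rwords (3 * m)))"
    if v: "qre v = 0" and \<rho>: "0 < \<rho>" "\<rho> * 5 ^ m \<le> sqrt (qnrm v)" for m v \<rho>
  proof -
    define r where "r = sqrt (qnrm v)"
    have "0 < \<rho> * 5 ^ m" using \<rho> by simp
    then have r: "r > 0" using \<rho>(2) unfolding r_def by linarith
    then have "qnrm v > 0" unfolding r_def by (simp only: real_sqrt_gt_0_iff)
    then obtain u where u: "qre u = 0" "qnrm u = 1" "v = qscalar r * u"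
      using scaled_unit[OF v] unfolding r_def by blast
    have "cell3 \<rho> (qact q v) = cell3 (\<rho> / r) (qact q u)" for q
      unfolding u(3) qact_scale cell3_def using r by (simp add: qscalar_mult mult.commute)
    then show ?thesis
      using c(2)[OF u(1,2), of "\<rho> / r" m] r \<rho> by (simp add: field_simps r_def)
  qed
  with c(1) show ?thesis by blast
qed

lemma height_cells_scaled:
  fixes \<eta> :: real
  assumes "\<eta> > 0"
  shows "\<exists>c>0. \<forall>m v \<rho>. qre v = 0 \<longrightarrow> 0 < \<rho> \<longrightarrow> \<rho> * 5 ^ m \<le> sqrt (qnrm v) \<longrightarrow>
    c * 5 powr (real m * (1 - \<eta>)) \<le>
      real (card ((\<lambda>ws. \<lfloor>qk (qact (rquat (prod_list ws)) v) / \<rho>\<rfloor>) ` rwords (3 * m)))"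
proof -
  obtain c where c: "c > 0" "\<And>m v \<rho>. qre v = 0 \<Longrightarrow> qnrm v = 1 \<Longrightarrow> 0 < \<rho> \<Longrightarrow> \<rho> \<le> 1 / 5 ^ m \<Longrightarrow>
    c * 5 powr (real m * (1 - \<eta>)) \<le>
      real (card ((\<lambda>ws. \<lfloor>qk (qact (rquat (prod_list ws)) v) / \<rho>\<rfloor>) ` rwords (3 * m)))"
    using height_cells[OF assms] by auto
  have "c * 5 powr (real m * (1 - \<eta>)) \<le>
      real (card ((\<lambda>ws. \<lfloor>qk (qact (rquat (prod_list ws)) v) / \<rho>\<rfloor>) ` rwords (3 * m)))"
    if v: "qre v = 0" and \<rho>: "0 < \<rho>" "\<rho> * 5 ^ m \<le> sqrt (qnrm v)" for m v \<rho>
  proof -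
    define r where "r = sqrt (qnrm v)"
    have "0 < \<rho> * 5 ^ m" using \<rho> by simp
    then have r: "r > 0" using \<rho>(2) unfolding r_def by linarith
    then have "qnrm v > 0" unfolding r_def by (simp only: real_sqrt_gt_0_iff)
    then obtain u where u: "qre u = 0" "qnrm u = 1" "v = qscalar r * u"
      using scaled_unit[OF v] unfolding r_def by blast
    have "\<lfloor>qk (qact q v) / \<rho>\<rfloor> = \<lfloor>qk (qact q u) / (\<rho> / r)\<rfloor>" for q
      unfolding u(3) qact_scale using r by (simp add: qscalar_mult mult.commute)
    then show ?thesis
      using c(2)[OF u(1,2), of "\<rho> / r" m] r \<rho> by (simp add: field_simps r_def)
  qed
  with c(1) show ?thesis by blast
qed

section \<open>Rotations of coordinate 3-spaces and the orbits they generate\<close>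

definition vec3 :: "'n \<Rightarrow> 'n \<Rightarrow> 'n \<Rightarrow> real ^ 'n \<Rightarrow> real quat" where
  "vec3 a b c x = Quat 0 (x $ a) (x $ b) (x $ c)"

definition rot :: "'n \<Rightarrow> 'n \<Rightarrow> 'n \<Rightarrow> int quat \<Rightarrow> real ^ 'n \<Rightarrow> real ^ ('n::finite)" where
  "rot a b c q x = (let y = qact (rquat q) (vec3 a b c x) in
    \<chi> i. if i = a then qi y else if i = b then qj y else if i = c then qk y else x $ i)"

lemma rot_other: "i \<noteq> a \<Longrightarrow> i \<noteq> b \<Longrightarrow> i \<noteq> c \<Longrightarrow> rot a b c q x $ i = x $ i"
  by (simp add: rot_def Let_def)

lemma vec3_rot:
  assumes "distinct [a, b, c]"
  shows "vec3 a b c (rot a b c q x) = qact (rquat q) (vec3 a b c x)"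
proof -
  have "qre (qact (rquat q) (vec3 a b c x)) = 0" by (rule qre_qact) (simp add: vec3_def)
  then show ?thesis
    using assms by (cases "qact (rquat q) (vec3 a b c x)") (auto simp: vec3_def rot_def Let_def)
qed

lemma vec3_eqI:
  assumes "vec3 a b c x = vec3 a b c y" "\<And>i. i \<notin> {a, b, c} \<Longrightarrow> x $ i = y $ i"
  shows "x = y"
proof (subst vec_eq_iff, rule allI)
  fix i
  show "x $ i = y $ i" using assms(1) assms(2)[of i] by (auto simp: vec3_def)
qed

lemma rot_mult:
  assumes "distinct [a, b, c]"
  shows "rot a b c (p * q) x = rot a b c p (rot a b c q x)"
  by (rule vec3_eqI[of a b c])
    (use assms in \<open>simp_all add: vec3_rot rquat_mult qact_mult rot_other del: distinct.simps\<close>)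

lemma rquat_one [simp]: "rquat 1 = 1"
  by (simp add: rquat_def one_quat_def)

lemma rot_one: "distinct [a, b, c] \<Longrightarrow> rot a b c 1 x = x"
  by (rule vec3_eqI[of a b c]) (simp_all add: vec3_rot rot_other del: distinct.simps)

lemma rot_scaleR:
  assumes "distinct [a, b, c]"
  shows "rot a b c q (t *\<^sub>R x) = t *\<^sub>R rot a b c q x"
proof (rule vec3_eqI[of a b c])
  have s: "vec3 a b c (t *\<^sub>R x) = qscalar t * vec3 a b c x" for x
    by (simp add: vec3_def qscalar_mult)
  show "vec3 a b c (rot a b c q (t *\<^sub>R x)) = vec3 a b c (t *\<^sub>R rot a b c q x)"
    by (simp only: vec3_rot[OF assms] s qact_scale)
qed (simp add: rot_other)

lemma rot_diff:
  assumes "distinct [a, b, c]"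
  shows "rot a b c q (x - y) = rot a b c q x - rot a b c q y"
proof (rule vec3_eqI[of a b c])
  have s: "vec3 a b c (x - y) = vec3 a b c x - vec3 a b c y" for x y
    by (simp add: vec3_def minus_quat_def)
  show "vec3 a b c (rot a b c q (x - y)) = vec3 a b c (rot a b c q x - rot a b c q y)"
    by (simp only: vec3_rot[OF assms] s) (simp add: qact_def right_diff_distrib left_diff_distrib)
qed (simp add: rot_other)

lemma norm_vec3:
  fixes x :: "real ^ 'n::finite"
  assumes "distinct [a, b, c]"
  shows "(norm x)\<^sup>2 = qnrm (vec3 a b c x) + (\<Sum>i\<in>-{a, b, c}. (x $ i)\<^sup>2)"
proof -
  have "(norm x)\<^sup>2 = (\<Sum>i\<in>UNIV. (x $ i)\<^sup>2)"
    by (simp add: norm_vec_def L2_set_def sum_nonneg)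
  also have "\<dots> = (\<Sum>i\<in>{a, b, c}. (x $ i)\<^sup>2) + (\<Sum>i\<in>-{a, b, c}. (x $ i)\<^sup>2)"
    by (subst sum.union_disjoint[symmetric]) auto
  also have "(\<Sum>i\<in>{a, b, c}. (x $ i)\<^sup>2) = qnrm (vec3 a b c x)"
    using assms by (simp add: qnrm_def vec3_def)
  finally show ?thesis .
qed

lemma norm_rot:
  assumes "distinct [a, b, c]" "qnrm q \<noteq> 0"
  shows "norm (rot a b c q x) = norm x"
proof -
  have "(norm (rot a b c q x))\<^sup>2 = (norm x)\<^sup>2"
    unfolding norm_vec3[OF assms(1)] vec3_rot[OF assms(1)]
    using assms(2) by (simp add: qnrm_qact qnrm_rquat rot_other)
  then show ?thesis by simp
qed

text \<open>Here \<open>J\<close> is the set of coordinates that may move. The identity makes orbits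
  increase with the word length, so shorter words can be padded.\<close>

definition gens :: "'n set \<Rightarrow> (real ^ 'n \<Rightarrow> real ^ ('n::finite)) set" where
  "gens J = insert id {rot a b c q |a b c q. a \<in> J \<and> b \<in> J \<and> c \<in> J \<and> distinct [a, b, c] \<and> q \<in> letters}"

lemma finite_gens [simp]: "finite (gens J)"
proof -
  have "gens J \<subseteq> insert id ((\<lambda>(a, b, c, q). rot a b c q) ` (UNIV \<times> UNIV \<times> UNIV \<times> letters))"
  proof
    fix g assume g: "g \<in> gens J"
    show "g \<in> insert id ((\<lambda>(a, b, c, q). rot a b c q) ` (UNIV \<times> UNIV \<times> UNIV \<times> letters))"
    proof (cases "g = id")
      case False
      then obtain a b c q where "g = rot a b c q" "q \<in> letters" using g unfolding gens_def by blast
      then show ?thesis by (intro insertI2 image_eqI[where x = "(a, b, c, q)"]) auto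
    qed simp
  qed
  then show ?thesis by (rule finite_subset) auto
qed

lemma gens_mono: "J \<subseteq> K \<Longrightarrow> gens J \<subseteq> gens K"
  unfolding gens_def by blast

lemma gens_cases:
  assumes "g \<in> gens J"
  obtains "g = id" | a b c q where "g = rot a b c q" "a \<in> J" "b \<in> J" "c \<in> J" "distinct [a, b, c]" "qnrm q \<noteq> 0"
  using assms letters_qnrm unfolding gens_def by fastforce

lemma gens_outside: "g \<in> gens J \<Longrightarrow> i \<notin> J \<Longrightarrow> g x $ i = x $ i"
  by (elim gens_cases) (auto intro!: rot_other)

lemma gens_norm: "g \<in> gens J \<Longrightarrow> norm (g x) = norm x"
  by (elim gens_cases) (auto simp: norm_rot simp del: distinct.simps)

lemma gens_scaleR: "g \<in> gens J \<Longrightarrow> g (t *\<^sub>R x) = t *\<^sub>R g x"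
  by (elim gens_cases) (auto simp: rot_scaleR simp del: distinct.simps)

lemma gens_dist: "g \<in> gens J \<Longrightarrow> dist (g x) (g y) = dist x y"
  by (elim gens_cases) (auto simp: dist_norm norm_rot simp del: distinct.simps simp flip: rot_diff)

primrec orb :: "('a \<Rightarrow> 'a) set \<Rightarrow> nat \<Rightarrow> 'a \<Rightarrow> 'a set" where
  "orb G 0 x = {x}"
| "orb G (Suc L) x = (\<Union>g\<in>G. g ` orb G L x)"

lemma finite_orb: "finite G \<Longrightarrow> finite (orb G L x)"
  by (induction L) auto

lemma orb_trans: "y \<in> orb G L x \<Longrightarrow> z \<in> orb G M y \<Longrightarrow> z \<in> orb G (M + L) x"
  by (induction M arbitrary: z) auto

lemma orb_subset_Suc:
  assumes "id \<in> G"
  shows "orb G L x \<subseteq> orb G (Suc L) x"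
proof
  fix y assume "y \<in> orb G L x"
  then have "id y \<in> orb G (Suc L) x" unfolding orb.simps using assms by blast
  then show "y \<in> orb G (Suc L) x" by simp
qed

lemma orb_mono_length: "id \<in> G \<Longrightarrow> L \<le> M \<Longrightarrow> orb G L x \<subseteq> orb G M x"
  by (rule lift_Suc_mono_le) (rule orb_subset_Suc)

lemma orb_mono_set: "G \<subseteq> H \<Longrightarrow> orb G L x \<subseteq> orb H L x"
  by (induction L) auto

lemma orb_gens_outside: "y \<in> orb (gens J) L x \<Longrightarrow> i \<notin> J \<Longrightarrow> y $ i = x $ i"
  by (induction L arbitrary: y) (auto simp: gens_outside)

lemma id_in_gens [simp]: "id \<in> gens J"
  by (simp add: gens_def)

lemma rot_word_in_orb:
  assumes "set ws \<subseteq> letters" "a \<in> J" "b \<in> J" "c \<in> J" "distinct [a, b, c]"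
  shows "rot a b c (prod_list ws) x \<in> orb (gens J) (length ws) x"
  using assms(1)
proof (induction ws)
  case Nil
  then show ?case using assms(5) by (simp add: rot_one del: distinct.simps)
next
  case (Cons q ws)
  then have "rot a b c (prod_list ws) x \<in> orb (gens J) (length ws) x" by simp
  moreover have "q \<in> letters" using Cons.prems by simp
  then have "rot a b c q \<in> gens J" using assms(2-5) unfolding gens_def by blast
  ultimately show ?case
    using assms(5) by (auto simp: rot_mult simp del: distinct.simps)
qed

section \<open>Counting cells by induction on the number of moving coordinates\<close>

definition cell :: "real \<Rightarrow> real ^ 'n \<Rightarrow> 'n \<Rightarrow> int" where
  "cell \<rho> x = (\<lambda>i. \<lfloor>x $ i / \<rho>\<rfloor>)"

text \<open>The length \<open>3 * m + 1\<close> fits the pattern of \<open>orbit_cells\<close>,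
  where each further dimension costs \<open>3 * m\<close> letters for the heights and one for
  \<open>spread_coordinates\<close>.\<close>

lemma orbit_cells_3:
  fixes \<eta> :: real
  assumes "\<eta> > 0"
  shows "\<exists>c>0. \<forall>(J::'n::finite set) m v \<rho>. card J = 3 \<longrightarrow> 0 < \<rho> \<longrightarrow>
    \<rho> * 5 ^ m \<le> L2_set (($) v) J \<longrightarrow>
    c * 5 powr (real m * (2 - \<eta>)) \<le> real (card (cell \<rho> ` orb (gens J) (3 * m + 1) v))"
proof -
  obtain c where c: "c > 0" "\<And>m v \<rho>. qre v = 0 \<Longrightarrow> 0 < \<rho> \<Longrightarrow> \<rho> * 5 ^ m \<le> sqrt (qnrm v) \<Longrightarrow>
    c * 5 powr (real m * (2 - \<eta>)) \<le>
      real (card ((\<lambda>ws. cell3 \<rho> (qact (rquat (prod_list ws)) v)) ` rwords (3 * m)))"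
    using sphere_cells_scaled[OF assms] by auto
  have "c * 5 powr (real m * (2 - \<eta>)) \<le> real (card (cell \<rho> ` orb (gens J) (3 * m + 1) v))"
    if J: "card J = 3" and \<rho>: "0 < \<rho>" "\<rho> * 5 ^ m \<le> L2_set (($) v) J" for J :: "'n set" and m v \<rho>
  proof -
    obtain a b d where abd: "J = {a, b, d}" "distinct [a, b, d]"
      using J by (auto simp: card_3_iff)
    define \<phi> where "\<phi> = (\<lambda>k :: 'n \<Rightarrow> int. (k a, k b, k d))"
    have fin: "finite (cell \<rho> ` orb (gens J) (3 * m + 1) v)" by (simp add: finite_orb del: orb.simps)
    have "(\<lambda>ws. cell3 \<rho> (qact (rquat (prod_list ws)) (vec3 a b d v))) ` rwords (3 * m)
        \<subseteq> \<phi> ` cell \<rho> ` orb (gens J) (3 * m + 1) v"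
    proof (rule image_subsetI)
      fix ws assume "ws \<in> rwords (3 * m)"
      then have ws: "set ws \<subseteq> letters" "length ws = 3 * m" by (auto simp: rwords_def reduced_def)
      define y where "y = rot a b d (prod_list ws) v"
      have "y \<in> orb (gens J) (length ws) v"
        unfolding y_def by (rule rot_word_in_orb) (use ws abd in auto)
      then have y: "y \<in> orb (gens J) (3 * m + 1) v"
        using orb_mono_length[of "gens J" "3 * m" "3 * m + 1" v] ws(2) by (auto simp del: orb.simps)
      have "cell3 \<rho> (qact (rquat (prod_list ws)) (vec3 a b d v)) = cell3 \<rho> (vec3 a b d y)"
        unfolding y_def vec3_rot[OF abd(2)] ..
      also have "\<dots> = \<phi> (cell \<rho> y)" by (simp add: \<phi>_def cell_def cell3_def vec3_def)
      finally show "cell3 \<rho> (qact (rquat (prod_list ws)) (vec3 a b d v))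
          \<in> \<phi> ` cell \<rho> ` orb (gens J) (3 * m + 1) v" using y by (simp del: orb.simps)
    qed
    then have "card ((\<lambda>ws. cell3 \<rho> (qact (rquat (prod_list ws)) (vec3 a b d v))) ` rwords (3 * m))
        \<le> card (cell \<rho> ` orb (gens J) (3 * m + 1) v)"
      using surj_card_le[OF fin] by blast
    moreover have "L2_set (($) v) J = sqrt (qnrm (vec3 a b d v))"
      using abd by (simp add: L2_set_def qnrm_def vec3_def add.assoc)
    then have "c * 5 powr (real m * (2 - \<eta>)) \<le>
        real (card ((\<lambda>ws. cell3 \<rho> (qact (rquat (prod_list ws)) (vec3 a b d v))) ` rwords (3 * m)))"
      using \<rho> by (intro c(2)) (auto simp: vec3_def)
    ultimately show ?thesis by linarith
  qed
  with c(1) show ?thesis by blast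
qed

text \<open>The letter \<open>1 \<plusminus> 2k\<close> rotates the first two coordinates by the angle with cosine \<open>-3/5\<close>;
  the sign is chosen so that nothing cancels in the first one.\<close>

lemma spread_coordinates:
  fixes v :: "real ^ 'n::finite"
  assumes "i \<in> J" "b \<in> J" "d \<in> J" "distinct [i, b, d]" "\<bar>v $ b\<bar> \<le> \<bar>v $ i\<bar>"
  obtains u where "u \<in> orb (gens J) 1 v" "\<bar>v $ i\<bar> / 5 \<le> \<bar>u $ i\<bar>" "\<bar>v $ i\<bar> / 5 \<le> \<bar>u $ b\<bar>"
proof -
  define \<sigma> :: int where "\<sigma> = (if v $ i * v $ b \<ge> 0 then 1 else - 1)"
  define q where "q = Quat 1 0 0 (2 * \<sigma>)"
  have q: "q \<in> letters" by (simp add: q_def letters_def \<sigma>_def)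
  define u where "u = rot i b d q v"
  have "u \<in> orb (gens J) 1 v"
    using assms(1-4) q unfolding u_def One_nat_def orb.simps gens_def by blast
  moreover have "u $ i = (- 3 * v $ i - 4 * \<sigma> * v $ b) / 5" "u $ b = (4 * \<sigma> * v $ i - 3 * v $ b) / 5"
    using assms(4) unfolding u_def q_def \<sigma>_def
    by (auto simp: rot_def Let_def qact_def rquat_def vec3_def qcnj_def times_quat_def qnrm_def algebra_simps
        diff_divide_distrib add_divide_distrib)
  moreover have "(v $ i \<ge> 0 \<and> v $ b \<ge> 0 \<or> v $ i \<le> 0 \<and> v $ b \<le> 0) \<and> \<sigma> = 1 \<or>
      (v $ i \<ge> 0 \<and> v $ b \<le> 0 \<or> v $ i \<le> 0 \<and> v $ b \<ge> 0) \<and> \<sigma> = - 1"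
    by (auto simp: \<sigma>_def zero_le_mult_iff)
  \<comment> \<open>The second coordinate may suffer cancellation, but
    \<open>4 * \<bar>v $ i\<bar> - 3 * \<bar>v $ b\<bar>\<close> is still at least
    \<open>\<bar>v $ i\<bar>\<close>; this gives the constant 1/5.\<close>
  ultimately show thesis using that[of u] assms(5) by (auto simp: abs_if split: if_splits)
qed

text \<open>For the step, first make two coordinates \<open>i\<close> and \<open>b\<close> large. A
  rotation in three coordinates containing \<open>b\<close> but not \<open>i\<close> then gives
  about \<open>5 ^ m\<close> heights in direction \<open>b\<close>. Above each height the induction
  hypothesis applies to \<open>J - {b}\<close>, where \<open>i\<close> keeps the vector large, and
  since \<open>b\<close> is now frozen the cells above different heights are disjoint. The exponents
  add up, and \<open>\<kappa>\<close> collects the losses in length.\<close>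

theorem orbit_cells:
  assumes "j \<ge> 3"
  shows "\<exists>\<kappa>>0. \<forall>\<eta>>0. \<exists>c>0. \<forall>(J::'n::finite set) m v \<rho>. card J = j \<longrightarrow> 0 < \<rho> \<longrightarrow>
    \<rho> * 5 ^ m \<le> \<kappa> * L2_set (($) v) J \<longrightarrow>
    c * 5 powr (real m * (real j - 1 - \<eta>)) \<le> real (card (cell \<rho> ` orb (gens J) ((3 * m + 1) * (j - 2)) v))"
  using assms
proof (induction j rule: nat_induct_at_least)
  case base
  have e: "real 3 - 1 - \<eta> = 2 - \<eta>" "(3 * m + 1) * (3 - 2) = 3 * m + 1" for \<eta> :: real and m :: nat
    by simp_all
  show ?case unfolding e
    by (rule exI[of _ "1::real"], rule conjI, simp, rule allI, rule impI)
      (use orbit_cells_3 in \<open>simp only: mult_1_left\<close>)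
next
  case (Suc j)
  obtain \<kappa> where \<kappa>: "\<kappa> > 0" and IH: "\<And>\<eta>. \<eta> > 0 \<Longrightarrow> \<exists>c>0. \<forall>(J::'n set) m v \<rho>. card J = j \<longrightarrow> 0 < \<rho> \<longrightarrow>
    \<rho> * 5 ^ m \<le> \<kappa> * L2_set (($) v) J \<longrightarrow>
    c * 5 powr (real m * (real j - 1 - \<eta>)) \<le> real (card (cell \<rho> ` orb (gens J) ((3 * m + 1) * (j - 2)) v))"
    using Suc.IH by blast
  \<comment> \<open>The largest of \<open>Suc j\<close> coordinates is at least the length divided
    by \<open>sqrt (real (Suc j))\<close>, and \<open>spread_coordinates\<close> loses a factor
    5.\<close>
  define \<mu> :: real where "\<mu> = 1 / (5 * sqrt (real (Suc j)))"
  have \<mu>: "\<mu> > 0" by (simp add: \<mu>_def)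
  define \<kappa>' where "\<kappa>' = \<mu> * min 1 \<kappa>"
  have "\<exists>c>0. \<forall>(J::'n set) m v \<rho>. card J = Suc j \<longrightarrow> 0 < \<rho> \<longrightarrow>
    \<rho> * 5 ^ m \<le> \<kappa>' * L2_set (($) v) J \<longrightarrow>
    c * 5 powr (real m * (real (Suc j) - 1 - \<eta>)) \<le>
      real (card (cell \<rho> ` orb (gens J) ((3 * m + 1) * (Suc j - 2)) v))" if \<eta>: "\<eta> > 0" for \<eta>
  proof -
    obtain c1 where c1: "c1 > 0" "\<And>(J::'n set) m v \<rho>. card J = j \<Longrightarrow> 0 < \<rho> \<Longrightarrow>
      \<rho> * 5 ^ m \<le> \<kappa> * L2_set (($) v) J \<Longrightarrow>
      c1 * 5 powr (real m * (real j - 1 - \<eta> / 2)) \<le> real (card (cell \<rho> ` orb (gens J) ((3 * m + 1) * (j - 2)) v))"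
      using IH[of "\<eta> / 2"] \<eta> by (auto simp del: orb.simps)
    obtain c2 where c2: "c2 > 0" "\<And>m v \<rho>. qre v = 0 \<Longrightarrow> 0 < \<rho> \<Longrightarrow> \<rho> * 5 ^ m \<le> sqrt (qnrm v) \<Longrightarrow>
      c2 * 5 powr (real m * (1 - \<eta> / 2)) \<le>
        real (card ((\<lambda>ws. \<lfloor>qk (qact (rquat (prod_list ws)) v) / \<rho>\<rfloor>) ` rwords (3 * m)))"
      using height_cells_scaled[of "\<eta> / 2"] \<eta> by auto
    have "c1 * c2 * 5 powr (real m * (real (Suc j) - 1 - \<eta>)) \<le>
      real (card (cell \<rho> ` orb (gens J) ((3 * m + 1) * (Suc j - 2)) v))"
      if J: "card J = Suc j" and \<rho>: "0 < \<rho>" "\<rho> * 5 ^ m \<le> \<kappa>' * L2_set (($) v) J"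
      for J :: "'n set" and m v \<rho>
    proof -
      define s where "s = L2_set (($) v) J"
      have s0: "s \<ge> 0" by (simp add: s_def)
      have "J \<noteq> {}" using J by auto
      then obtain i where i: "i \<in> J" "\<And>k. k \<in> J \<Longrightarrow> \<bar>v $ k\<bar> \<le> \<bar>v $ i\<bar>"
        using obtains_MAX[of J "\<lambda>k. \<bar>v $ k\<bar>"] by (metis Max_ge finite_imageI finite imageI)
      have "card (J - {i}) = j" using J i by simp
      then obtain T where T: "T \<subseteq> J - {i}" "card T = 3"
        using obtain_subset_with_card_n[of 3 "J - {i}"] Suc.hyps by metis
      then obtain b d e where bde: "b \<in> J" "d \<in> J" "e \<in> J" "distinct [i, b, d, e]"
        by (auto simp: card_3_iff)
      have s_le: "\<mu> * s \<le> \<bar>v $ i\<bar> / 5"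
      proof -
        have "(\<Sum>k\<in>J. (v $ k)\<^sup>2) \<le> (\<Sum>k\<in>J. (v $ i)\<^sup>2)"
          by (intro sum_mono) (metis i(2) abs_le_square_iff)
        then have "(\<Sum>k\<in>J. (v $ k)\<^sup>2) \<le> real (Suc j) * (v $ i)\<^sup>2" using J by simp
        then have "s \<le> sqrt (real (Suc j) * (v $ i)\<^sup>2)" unfolding s_def L2_set_def by (rule real_sqrt_le_mono)
        also have "\<dots> = sqrt (real (Suc j)) * \<bar>v $ i\<bar>" by (simp add: real_sqrt_mult)
        finally have "\<mu> * s \<le> \<mu> * (sqrt (real (Suc j)) * \<bar>v $ i\<bar>)" using \<mu> by (intro mult_left_mono) auto
        also have "\<dots> = \<bar>v $ i\<bar> / 5" by (simp add: \<mu>_def)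
        finally show ?thesis .
      qed
      obtain u where u: "u \<in> orb (gens J) 1 v" "\<bar>v $ i\<bar> / 5 \<le> \<bar>u $ i\<bar>" "\<bar>v $ i\<bar> / 5 \<le> \<bar>u $ b\<bar>"
        by (rule spread_coordinates[of i J b d v]) (use i bde in auto)
      have \<rho>1: "\<rho> * 5 ^ m \<le> \<mu> * s" "\<rho> * 5 ^ m \<le> \<kappa> * (\<mu> * s)"
      proof -
        have "\<kappa>' * s \<le> \<mu> * s" "\<kappa>' * s \<le> (\<kappa> * \<mu>) * s"
          unfolding \<kappa>'_def using s0 \<mu> \<kappa> by (intro mult_right_mono; simp add: min_def mult.commute)+
        then show "\<rho> * 5 ^ m \<le> \<mu> * s" "\<rho> * 5 ^ m \<le> \<kappa> * (\<mu> * s)"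
          using \<rho>(2) by (simp_all add: s_def mult.assoc)
      qed
      \<comment> \<open>The coordinate \<open>b\<close> stands in the third place, the one whose
        values \<open>height_cells_scaled\<close> counts.\<close>
      define y where "y = (\<lambda>ws. rot d e b (prod_list ws) u)"
      define g where "g = (\<lambda>ws. \<lfloor>y ws $ b / \<rho>\<rfloor>)"
      define W where "W = rwords (3 * m)"
      have deb: "distinct [d, e, b]" using bde by auto
      have "qnrm (vec3 d e b u) \<ge> (u $ b)\<^sup>2" by (simp add: qnrm_def vec3_def)
      then have "sqrt (qnrm (vec3 d e b u)) \<ge> \<bar>u $ b\<bar>" by (metis real_sqrt_abs real_sqrt_le_mono)
      then have "\<rho> * 5 ^ m \<le> sqrt (qnrm (vec3 d e b u))" using \<rho>1(1) s_le u(3) by linarith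
      then have "c2 * 5 powr (real m * (1 - \<eta> / 2)) \<le>
          real (card ((\<lambda>ws. \<lfloor>qk (qact (rquat (prod_list ws)) (vec3 d e b u)) / \<rho>\<rfloor>) ` W))"
        unfolding W_def by (intro c2(2) \<rho>(1)) (simp add: vec3_def)
      moreover have "qk (qact (rquat (prod_list ws)) (vec3 d e b u)) = y ws $ b" for ws
        unfolding y_def vec3_rot[OF deb, symmetric] by (simp add: vec3_def)
      ultimately have cg: "c2 * 5 powr (real m * (1 - \<eta> / 2)) \<le> real (card (g ` W))"
        by (simp add: g_def)
      define L where "L = (3 * m + 1) * (j - 2)"
      \<comment> \<open>The slice above the height \<open>t\<close>: one word reaching that height
        is chosen, and only the coordinates in \<open>J - {b}\<close> move afterwards.\<close>
      define Y where "Y = (\<lambda>t. cell \<rho> ` orb (gens (J - {b})) L (y (chosen g W t)))"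
      have finY: "finite (Y t)" for t by (simp add: Y_def finite_orb)
      have cY: "c1 * 5 powr (real m * (real j - 1 - \<eta> / 2)) \<le> real (card (Y t))" for t
        unfolding Y_def L_def
      proof (rule c1(2)[OF _ \<rho>(1)])
        show "card (J - {b}) = j" using J bde by simp
        let ?x = "y (chosen g W t)"
        have "?x $ i = u $ i" unfolding y_def by (rule rot_other) (use bde in auto)
        moreover have "\<bar>?x $ i\<bar> \<le> L2_set (($) ?x) (J - {b})"
          using member_le_L2_set[of "J - {b}" i "\<lambda>k. \<bar>?x $ k\<bar>"] i bde by (simp add: L2_set_def)
        ultimately have "\<mu> * s \<le> L2_set (($) ?x) (J - {b})" using u(2) s_le by linarith
        then have "\<kappa> * (\<mu> * s) \<le> \<kappa> * L2_set (($) ?x) (J - {b})" using \<kappa> by simp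
        then show "\<rho> * 5 ^ m \<le> \<kappa> * L2_set (($) ?x) (J - {b})" using \<rho>1(2) by linarith
      qed
      have Yb: "k b = t" if t: "t \<in> g ` W" and k: "k \<in> Y t" for t k
      proof -
        obtain z where z: "z \<in> orb (gens (J - {b})) L (y (chosen g W t))" "k = cell \<rho> z"
          using k by (auto simp: Y_def)
        have "z $ b = y (chosen g W t) $ b" using z(1) by (rule orb_gens_outside) simp
        then have "k b = g (chosen g W t)" using z(2) by (simp add: cell_def g_def)
        also have "\<dots> = t" using t chosen(2)[of _ W g] by auto
        finally show ?thesis .
      qed
      have "Y t \<subseteq> cell \<rho> ` orb (gens J) ((3 * m + 1) * (Suc j - 2)) v" if t: "t \<in> g ` W" for t
      proof -
        define w where "w = chosen g W t"
        have "w \<in> W" using t chosen(1)[of _ W g] by (auto simp: w_def)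
        then have w: "set w \<subseteq> letters" "length w = 3 * m" by (auto simp: W_def rwords_def reduced_def)
        have "y w \<in> orb (gens J) (3 * m) u"
          unfolding y_def w(2)[symmetric] by (rule rot_word_in_orb) (use w bde in auto)
        then have "y w \<in> orb (gens J) (3 * m + 1) v" using orb_trans[OF u(1)] by blast
        moreover have "orb (gens (J - {b})) L (y w) \<subseteq> orb (gens J) L (y w)"
          by (intro orb_mono_set gens_mono) auto
        ultimately have "orb (gens (J - {b})) L (y w) \<subseteq> orb (gens J) (L + (3 * m + 1)) v"
          using orb_trans[of "y w" "gens J" "3 * m + 1" v _ L] by (meson subset_iff)
        moreover have "L + (3 * m + 1) = (3 * m + 1) * (Suc j - 2)"
          using Suc.hyps unfolding L_def by (metis Suc_diff_le add.commute mult_Suc_right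
              numeral_2_eq_2 numeral_3_eq_3 Suc_leD)
        ultimately show ?thesis unfolding Y_def w_def by (simp only: image_mono)
      qed
      then have "(\<Union>t\<in>g ` W. Y t) \<subseteq> cell \<rho> ` orb (gens J) ((3 * m + 1) * (Suc j - 2)) v" by blast
      then have "card (\<Union>t\<in>g ` W. Y t) \<le> card (cell \<rho> ` orb (gens J) ((3 * m + 1) * (Suc j - 2)) v)"
        by (intro card_mono finite_imageI finite_orb finite_gens)
      moreover have "Y t \<inter> Y t' = {}" if "t \<in> g ` W" "t' \<in> g ` W" "t \<noteq> t'" for t t'
        using Yb[OF that(1)] Yb[OF that(2)] that(3) by blast
      then have "card (\<Union>t\<in>g ` W. Y t) = (\<Sum>t\<in>g ` W. card (Y t))"
        using finY finite_rwords unfolding W_def by (intro card_UN_disjoint ballI impI finite_imageI) assumption+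
      ultimately have "(\<Sum>t\<in>g ` W. real (card (Y t))) \<le>
          real (card (cell \<rho> ` orb (gens J) ((3 * m + 1) * (Suc j - 2)) v))"
        by (metis of_nat_le_iff of_nat_sum)
      moreover have "(\<Sum>t\<in>g ` W. c1 * 5 powr (real m * (real j - 1 - \<eta> / 2))) \<le> (\<Sum>t\<in>g ` W. real (card (Y t)))"
        by (intro sum_mono cY)
      moreover have "c2 * 5 powr (real m * (1 - \<eta> / 2)) * (c1 * 5 powr (real m * (real j - 1 - \<eta> / 2)))
          \<le> real (card (g ` W)) * (c1 * 5 powr (real m * (real j - 1 - \<eta> / 2)))"
        using c1(1) by (intro mult_right_mono cg) simp
      moreover have "c2 * 5 powr (real m * (1 - \<eta> / 2)) * (c1 * 5 powr (real m * (real j - 1 - \<eta> / 2)))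
          = c1 * c2 * (5 powr (real m * (1 - \<eta> / 2)) * 5 powr (real m * (real j - 1 - \<eta> / 2)))"
        by simp
      moreover have "5 powr (real m * (1 - \<eta> / 2)) * 5 powr (real m * (real j - 1 - \<eta> / 2))
          = 5 powr (real m * (real (Suc j) - 1 - \<eta>))"
        by (simp add: algebra_simps flip: powr_add)
      ultimately show ?thesis by simp
    qed
    moreover have "c1 * c2 > 0" using c1(1) c2(1) by simp
    ultimately show ?thesis by blast
  qed
  moreover have "\<kappa>' > 0" using \<mu> \<kappa> by (simp add: \<kappa>'_def)
  ultimately show ?case by blast
qed

section \<open>The attractors\<close>

definition levels :: "real \<Rightarrow> ('a \<Rightarrow> 'a) set \<Rightarrow> 'a set \<Rightarrow> 'a::real_normed_vector set" where
  "levels \<theta> G C = insert 0 (\<Union>L. \<Union>c\<in>C. (\<lambda>y. \<theta> ^ L *\<^sub>R y) ` orb G L c)"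

text \<open>The finite sets \<open>A L\<close> shrink to 0, so a member of the cover containing 0
  swallows all but finitely many of them.\<close>

lemma compact_insert_0_levels:
  fixes A :: "nat \<Rightarrow> 'a::real_normed_vector set"
  assumes "\<And>L. finite (A L)" "0 < r" "r < 1" "\<And>L x. x \<in> A L \<Longrightarrow> norm x \<le> r ^ L * B"
  shows "compact (insert 0 (\<Union>L. A L))"
proof (rule compactI)
  fix \<C> assume \<C>: "\<forall>t\<in>\<C>. open t" "insert 0 (\<Union>L. A L) \<subseteq> \<Union>\<C>"
  obtain U where U: "U \<in> \<C>" "0 \<in> U" using \<C> by auto
  then obtain e where e: "e > 0" "ball 0 e \<subseteq> U" using \<C>(1) by (meson openE)
  have "(\<lambda>L. r ^ L * B) \<longlonglongrightarrow> 0 * B"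
    using assms(2,3) by (intro tendsto_mult LIMSEQ_power_zero tendsto_const) auto
  then have "\<forall>\<^sub>F L in sequentially. r ^ L * B < e" using e(1) by (intro order_tendstoD(2)) auto
  then obtain L0 where L0: "\<And>L. L \<ge> L0 \<Longrightarrow> r ^ L * B < e" unfolding eventually_sequentially by blast
  have big: "A L \<subseteq> U" if "L \<ge> L0" for L
    using assms(4)[of _ L] L0[OF that] e(2) by (force simp: subset_iff)
  have "finite (\<Union>L<L0. A L)" using assms(1) by blast
  moreover have "(\<Union>L<L0. A L) \<subseteq> \<Union>\<C>" using \<C>(2) by blast
  ultimately obtain F where F: "finite F" "F \<subseteq> \<C>" "(\<Union>L<L0. A L) \<subseteq> \<Union>F"
    by (rule finite_subset_Union)
  have "insert 0 (\<Union>L. A L) \<subseteq> \<Union>(insert U F)"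
  proof
    fix x assume "x \<in> insert 0 (\<Union>L. A L)"
    then consider "x = 0" | L where "x \<in> A L" by auto
    then show "x \<in> \<Union>(insert U F)"
    proof cases
      case 1
      then show ?thesis using U by auto
    next
      case (2 L)
      then show ?thesis using big[of L] F(3) by (cases "L < L0") (auto simp: not_less)
    qed
  qed
  then show "\<exists>\<C>'\<subseteq>\<C>. finite \<C>' \<and> insert 0 (\<Union>L. A L) \<subseteq> \<Union>\<C>'"
    using F(1,2) U(1) by (intro exI[of _ "insert U F"]) auto
qed

locale scaled_isometries =
  fixes \<theta> :: real and G :: "('a::real_normed_vector \<Rightarrow> 'a) set"
  assumes theta: "0 < \<theta>" "\<theta> < 1"
    and finite_G: "finite G" and id_G: "id \<in> G"
    and norm_G: "g \<in> G \<Longrightarrow> norm (g x) = norm x"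
    and scale_G: "g \<in> G \<Longrightarrow> g (t *\<^sub>R x) = t *\<^sub>R g x"
begin

lemma norm_orb: "y \<in> orb G L x \<Longrightarrow> norm y = norm x"
  by (induction L arbitrary: y) (auto simp: norm_G)

lemma compact_levels:
  assumes "finite C"
  shows "compact (levels \<theta> G C)"
proof -
  obtain B where B: "\<And>c. c \<in> C \<Longrightarrow> norm c \<le> B"
    using finite_imp_bounded[OF assms] unfolding bounded_iff by blast
  show ?thesis unfolding levels_def
  proof (rule compact_insert_0_levels[where B = B, OF _ theta])
    show "finite (\<Union>c\<in>C. (\<lambda>y. \<theta> ^ L *\<^sub>R y) ` orb G L c)" for L
      using assms finite_G by (intro finite_UN_I finite_imageI finite_orb)
  next
    fix L x assume "x \<in> (\<Union>c\<in>C. (\<lambda>y. \<theta> ^ L *\<^sub>R y) ` orb G L c)"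
    then obtain c y where "c \<in> C" "y \<in> orb G L c" "x = \<theta> ^ L *\<^sub>R y" by auto
    then show "norm x \<le> \<theta> ^ L * B"
      using B[of c] norm_orb[of y L c] theta by (auto intro!: mult_left_mono)
  qed
qed

lemma levels_fixed:
  "levels \<theta> G C = (\<Union>g\<in>G. (\<lambda>x. \<theta> *\<^sub>R g x) ` levels \<theta> G C) \<union> C" (is "?F = ?R")
proof (intro equalityI subsetI)
  fix x assume "x \<in> ?F"
  then consider "x = 0" | L c y where "c \<in> C" "y \<in> orb G L c" "x = \<theta> ^ L *\<^sub>R y"
    unfolding levels_def by auto
  then show "x \<in> ?R"
  proof cases
    case 1
    have "\<theta> *\<^sub>R id (0::'a) \<in> (\<lambda>x. \<theta> *\<^sub>R id x) ` ?F" by (rule imageI) (simp add: levels_def)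
    then have "x \<in> (\<lambda>x. \<theta> *\<^sub>R id x) ` ?F" using 1 by simp
    then show ?thesis using id_G by blast
  next
    case (2 L c y)
    show ?thesis
    proof (cases L)
      case 0
      then show ?thesis using 2 by simp
    next
      case (Suc M)
      then obtain g z where gz: "g \<in> G" "z \<in> orb G M c" "y = g z" using 2 by auto
      have "\<theta> ^ M *\<^sub>R z \<in> ?F" using gz 2 unfolding levels_def by blast
      moreover have "x = \<theta> *\<^sub>R g (\<theta> ^ M *\<^sub>R z)" using 2 Suc gz by (simp add: scale_G)
      ultimately show ?thesis using gz by blast
    qed
  qed
next
  fix x assume "x \<in> ?R"
  then consider "x \<in> C" | g y where "g \<in> G" "y \<in> ?F" "x = \<theta> *\<^sub>R g y" by auto
  then show "x \<in> ?F"
  proof cases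
    case 1
    then have "\<theta> ^ 0 *\<^sub>R x \<in> ?F" unfolding levels_def using orb.simps(1)[of G x] by blast
    then show ?thesis by simp
  next
    case (2 g y)
    from 2(2) consider "y = 0" | L c z where "c \<in> C" "z \<in> orb G L c" "y = \<theta> ^ L *\<^sub>R z"
      unfolding levels_def by auto
    then show ?thesis
    proof cases
      case 1
      then have "x = 0" using 2 norm_G[OF 2(1), of 0] by simp
      then show ?thesis by (simp add: levels_def)
    next
      case (2 L c z)
      have "g z \<in> orb G (Suc L) c" using \<open>g \<in> G\<close> 2 by auto
      moreover have "x = \<theta> ^ Suc L *\<^sub>R g z" using \<open>x = \<theta> *\<^sub>R g y\<close> 2 \<open>g \<in> G\<close> by (simp add: scale_G)
      ultimately show ?thesis using 2(1) unfolding levels_def by blast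
    qed
  qed
qed

text \<open>Unwinding the equation \<open>n\<close> times, a point of \<open>F\<close> outside
  \<open>levels \<theta> G C\<close> would have norm \<open>\<theta> ^ n\<close> times that of a
  point of the bounded set \<open>F\<close>, hence would be 0. Conversely, \<open>F\<close> contains
  0 as the limit of \<open>\<theta> ^ n *\<^sub>R y\<close>, and all images of \<open>C\<close> by
  induction on the word length.\<close>

lemma levels_unique:
  assumes F: "compact F" "F \<noteq> {}" "F = (\<Union>g\<in>G. (\<lambda>x. \<theta> *\<^sub>R g x) ` F) \<union> C"
  shows "F = levels \<theta> G C"
proof (intro equalityI subsetI)
  fix x assume x: "x \<in> F"
  obtain B where B: "\<And>y. y \<in> F \<Longrightarrow> norm y \<le> B"
    using compact_imp_bounded[OF F(1)] unfolding bounded_iff by blast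
  have step: "x \<in> levels \<theta> G C \<or> (\<exists>y\<in>F. norm x = \<theta> ^ n * norm y)" if "x \<in> F" for n x
    using that
  proof (induction n arbitrary: x)
    case (Suc n)
    consider "x \<in> C" | g y where "g \<in> G" "y \<in> F" "x = \<theta> *\<^sub>R g y" using Suc.prems F(3) by blast
    then show ?case
    proof cases
      case 1
      then show ?thesis using levels_fixed[of C] by blast
    next
      case (2 g y)
      from Suc.IH[OF 2(2)] show ?thesis
      proof
        assume "y \<in> levels \<theta> G C"
        then show ?thesis using 2 levels_fixed[of C] by blast
      next
        assume "\<exists>z\<in>F. norm y = \<theta> ^ n * norm z"
        then show ?thesis using 2 theta by (auto simp: norm_G mult.assoc)
      qed
    qed
  qed auto
  show "x \<in> levels \<theta> G C"
  proof (rule ccontr)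
    assume nx: "x \<notin> levels \<theta> G C"
    then have "norm x \<le> \<theta> ^ n * B" for n
      using step[OF x, of n] B theta by (auto intro!: mult_left_mono)
    moreover have "(\<lambda>n. \<theta> ^ n * B) \<longlonglongrightarrow> 0 * B"
      using theta by (intro tendsto_mult LIMSEQ_power_zero tendsto_const) auto
    ultimately have "norm x \<le> 0" by (intro LIMSEQ_le_const[of _ 0]) auto
    then show False using nx by (simp add: levels_def)
  qed
next
  fix x assume "x \<in> levels \<theta> G C"
  then consider "x = 0" | L c y where "c \<in> C" "y \<in> orb G L c" "x = \<theta> ^ L *\<^sub>R y"
    unfolding levels_def by auto
  then show "x \<in> F"
  proof cases
    case 1
    obtain y where y: "y \<in> F" using F(2) by blast
    have "\<theta> ^ n *\<^sub>R y \<in> F" for n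
    proof (induction n)
      case (Suc n)
      then have "\<theta> *\<^sub>R id (\<theta> ^ n *\<^sub>R y) \<in> F" using F(3) id_G by blast
      then show ?case by simp
    qed (use y in simp)
    moreover have "(\<lambda>n. \<theta> ^ n *\<^sub>R y) \<longlonglongrightarrow> 0 *\<^sub>R y"
      using theta by (intro tendsto_scaleR LIMSEQ_power_zero tendsto_const) auto
    ultimately show ?thesis
      using closed_sequentially[OF compact_imp_closed[OF F(1)], of "\<lambda>n. \<theta> ^ n *\<^sub>R y" 0] 1
      by simp
  next
    case (2 L c y)
    have "\<theta> ^ L *\<^sub>R y \<in> F"
      using 2(2)
    proof (induction L arbitrary: y)
      case 0
      then show ?case using 2(1) F(3) by auto
    next
      case (Suc L)
      then obtain g z where gz: "g \<in> G" "z \<in> orb G L c" "y = g z" by auto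
      then have "\<theta> *\<^sub>R g (\<theta> ^ L *\<^sub>R z) \<in> F" using Suc.IH[of z] F(3) by blast
      then show ?case using gz by (simp add: scale_G)
    qed
    then show ?thesis using 2 by simp
  qed
qed

lemma inhom_attractor_eq:
  assumes "finite C" and S: "(\<lambda>i. S i) ` I = (\<lambda>g x. \<theta> *\<^sub>R g x) ` G"
  shows "inhom_attractor I S C = levels \<theta> G C"
proof -
  have U: "(\<Union>i\<in>I. S i ` F) = (\<Union>g\<in>G. (\<lambda>x. \<theta> *\<^sub>R g x) ` F)" for F
  proof -
    have "(\<Union>i\<in>I. S i ` F) = (\<Union>s\<in>(\<lambda>i. S i) ` I. s ` F)" by simp
    also have "\<dots> = (\<Union>g\<in>G. (\<lambda>x. \<theta> *\<^sub>R g x) ` F)" unfolding S by simp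
    finally show ?thesis .
  qed
  show ?thesis unfolding inhom_attractor_def U
  proof (rule the_equality)
    show "compact (levels \<theta> G C) \<and> levels \<theta> G C \<noteq> {} \<and>
        levels \<theta> G C = (\<Union>g\<in>G. (\<lambda>x. \<theta> *\<^sub>R g x) ` levels \<theta> G C) \<union> C"
      using compact_levels[OF assms(1)] levels_fixed[of C] unfolding levels_def by blast
  qed (use levels_unique in blast)
qed

end

section \<open>Mesh counts and the lower box dimension\<close>

lemma mesh_count_eq:
  assumes "\<delta> > 0"
  shows "mesh_count \<delta> E = card (cell \<delta> ` E)"
proof -
  have "(\<forall>i. of_int (k i) * \<delta> \<le> x $ i \<and> x $ i < (of_int (k i) + 1) * \<delta>) \<longleftrightarrow> k = cell \<delta> x" for k x
    using assms by (auto simp: cell_def fun_eq_iff floor_eq_iff field_simps eq_commute[of "k _"])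
  then have "{k. \<exists>x\<in>E. \<forall>i. of_int (k i) * \<delta> \<le> x $ i \<and> x $ i < (of_int (k i) + 1) * \<delta>} = cell \<delta> ` E"
    by auto
  then show ?thesis by (simp add: mesh_count_def)
qed

text \<open>An infinite set has \<open>card\<close> 0, so finiteness is what allows mesh counts to
  be bounded below by subsets.\<close>

lemma finite_cells:
  fixes E :: "(real ^ 'n::finite) set"
  assumes "bounded E" "\<delta> > 0"
  shows "finite (cell \<delta> ` E)"
proof -
  obtain B where B: "\<And>x. x \<in> E \<Longrightarrow> norm x \<le> B" using assms(1) unfolding bounded_iff by blast
  have "cell \<delta> ` E \<subseteq> Pi\<^sub>E UNIV (\<lambda>_. {\<lfloor>- B / \<delta>\<rfloor>..\<lfloor>B / \<delta>\<rfloor>})"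
  proof
    fix k assume "k \<in> cell \<delta> ` E"
    then obtain x where x: "x \<in> E" "k = cell \<delta> x" by blast
    have "\<bar>x $ i\<bar> \<le> B" for i using B[OF x(1)] component_le_norm_cart[of x i] by linarith
    then have "- B \<le> x $ i" "x $ i \<le> B" for i by (meson abs_le_D1 abs_le_D2 minus_le_iff)+
    then have "- B / \<delta> \<le> x $ i / \<delta>" "x $ i / \<delta> \<le> B / \<delta>" for i
      using assms(2) by (intro divide_right_mono; simp)+
    then show "k \<in> Pi\<^sub>E UNIV (\<lambda>_. {\<lfloor>- B / \<delta>\<rfloor>..\<lfloor>B / \<delta>\<rfloor>})"
      unfolding x(2) cell_def by (auto intro!: floor_mono)
  qed
  then show ?thesis by (rule finite_subset) (intro finite_PiE; simp)
qed

text \<open>For given \<open>\<delta>\<close>, take the largest \<open>m\<close> that the scale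
  condition admits, which is about \<open>- ln \<delta> / b\<close>. The count then has exponent
  \<open>a / b\<close>, and the strict gap above \<open>D\<close> absorbs all constants once
  \<open>\<delta>\<close> is small.\<close>

lemma lower_box_dim_geI:
  fixes E :: "(real ^ 'n::finite) set"
  assumes E: "bounded E" and K: "K > 0" "b > 0" "c > 0" and D: "D * b < a"
    and cells: "\<And>m \<delta>. 0 < \<delta> \<Longrightarrow> \<delta> * exp (real m * b) \<le> K \<Longrightarrow> c * exp (real m * a) \<le> real (mesh_count \<delta> E)"
    and a: "a > 0"
  shows "ereal D \<le> lower_box_dim E"
  unfolding lower_box_dim_def
proof (rule Liminf_bounded)
  \<comment> \<open>\<open>A\<close> collects the constants, including a loss of \<open>a\<close>
    from rounding \<open>m\<close> down. Beyond \<open>T\<close>, the gap \<open>a / b - D\<close>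
    times \<open>- ln \<delta>\<close> outweighs \<open>- A\<close>.\<close>
  define A where "A = ln c + (ln K / b - 1) * a"
  define T where "T = max 1 (- A / (a / b - D))"
  have gap: "a / b - D > 0" using D K by (simp add: field_simps)
  define \<delta>0 where "\<delta>0 = min K (exp (- T))"
  have "\<delta>0 > 0" using K by (simp add: \<delta>0_def)
  then have "\<forall>\<^sub>F \<delta> in at_right 0. \<delta> \<in> {0<..<\<delta>0}" by (rule eventually_at_right_real)
  then show "\<forall>\<^sub>F \<delta> in at_right 0. ereal D \<le> ereal (ln (real (mesh_count \<delta> E)) / - ln \<delta>)"
  proof eventually_elim
    case (elim \<delta>)
    then have \<delta>: "0 < \<delta>" "\<delta> < K" "\<delta> < exp (- T)" by (auto simp: \<delta>0_def)
    define u where "u = - ln \<delta>"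
    have "ln \<delta> < - T" using \<delta> by (metis exp_less_cancel_iff exp_ln)
    then have u: "u > T" "u > 0" by (auto simp: u_def T_def)
    define y where "y = (ln K + u) / b"
    have "ln \<delta> < ln K" using \<delta> K by simp
    then have y0: "y > 0" using K by (simp add: y_def u_def)
    define m where "m = nat \<lfloor>y\<rfloor>"
    have m: "real m \<le> y" "y - 1 \<le> real m" using y0 unfolding m_def by linarith+
    have "\<delta> * exp (real m * b) = exp (real m * b - u)" using \<delta>(1) by (simp add: u_def exp_add)
    also have "\<dots> \<le> exp (ln K)"
    proof -
      have "real m * b \<le> y * b" using m(1) K by (intro mult_right_mono) auto
      then show ?thesis unfolding exp_le_cancel_iff using K by (simp add: y_def)
    qed
    finally have "c * exp (real m * a) \<le> real (mesh_count \<delta> E)"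
      using K \<delta>(1) by (intro cells) auto
    moreover have "c * exp (real m * a) > 0" using K by simp
    ultimately have "ln (c * exp (real m * a)) \<le> ln (real (mesh_count \<delta> E))" by simp
    moreover have "ln (c * exp (real m * a)) = ln c + real m * a" using K by (simp add: ln_mult)
    moreover have "(y - 1) * a \<le> real m * a" using m(2) a by (intro mult_right_mono) auto
    moreover have "ln c + (y - 1) * a = A + a / b * u" by (simp add: A_def y_def algebra_simps add_divide_distrib)
    ultimately have 1: "A + a / b * u \<le> ln (real (mesh_count \<delta> E))" by linarith
    have "- A / (a / b - D) \<le> u" using u by (simp add: T_def)
    then have "- A \<le> u * (a / b - D)" by (simp only: pos_divide_le_eq[OF gap])
    then have "D * u \<le> A + a / b * u" by (simp add: algebra_simps)
    then have "D * u \<le> ln (real (mesh_count \<delta> E))" using 1 by linarith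
    then have "D \<le> ln (real (mesh_count \<delta> E)) / u" using u by (simp add: pos_le_divide_eq)
    then show ?case by (simp add: u_def)
  qed
qed

theorem theorem3p2:
  assumes "CARD('n::finite) \<ge> 3"
    and "(\<epsilon>::real) > 0"
  shows "\<exists>(I::nat set) (S::nat \<Rightarrow> real ^ 'n \<Rightarrow> real ^ 'n).
           finite I \<and> I \<noteq> {} \<and> (\<forall>i\<in>I. contracting_similarity (S i)) \<and>
           (\<exists>p. attractor I S = {p}) \<and>
           (\<forall>c. {c} \<noteq> attractor I S \<longrightarrow>
               ereal (real CARD('n) - 1 - \<epsilon>) \<le> lower_box_dim (inhom_attractor I S {c}))"
proof -
  define j where "j = CARD('n)"
  define D where "D = real j - 1"
  \<comment> \<open>Halving leaves \<open>\<epsilon> - \<eta>\<close> to pay for the contraction;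
    the cap 1 keeps \<open>D - \<eta>\<close> positive.\<close>
  define \<eta> where "\<eta> = min (\<epsilon> / 2) 1"
  have \<eta>: "0 < \<eta>" "\<eta> \<le> 1" "\<eta> < \<epsilon>" using assms(2) by (auto simp: \<eta>_def)
  have D: "D \<ge> 2" using assms(1) by (simp add: D_def j_def)
  obtain \<kappa> where \<kappa>: "\<kappa> > 0" and "\<And>\<eta>. \<eta> > 0 \<Longrightarrow> \<exists>c>0. \<forall>(J::'n set) m v \<rho>. card J = j \<longrightarrow> 0 < \<rho> \<longrightarrow>
    \<rho> * 5 ^ m \<le> \<kappa> * L2_set (($) v) J \<longrightarrow>
    c * 5 powr (real m * (real j - 1 - \<eta>)) \<le> real (card (cell \<rho> ` orb (gens J) ((3 * m + 1) * (j - 2)) v))"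
    using orbit_cells[of j] assms(1) unfolding j_def by blast
  from this(2)[OF \<eta>(1)] obtain c0 where c0: "c0 > 0" and orbc: "\<And>(J::'n set) m v \<rho>. card J = j \<Longrightarrow> 0 < \<rho> \<Longrightarrow>
    \<rho> * 5 ^ m \<le> \<kappa> * L2_set (($) v) J \<Longrightarrow>
    c0 * 5 powr (real m * (real j - 1 - \<eta>)) \<le> real (card (cell \<rho> ` orb (gens J) ((3 * m + 1) * (j - 2)) v))"
    by blast
  define \<alpha> where "\<alpha> = 3 * real (j - 2)"
  have \<alpha>: "\<alpha> \<ge> 0" by (simp add: \<alpha>_def)
  \<comment> \<open>Words of length about \<open>\<alpha> * m\<close> shrink the scale by a further
    \<open>exp (- \<alpha> * t * m)\<close>. This \<open>t\<close> makes
    \<open>D * (\<alpha> * t)\<close> smaller than \<open>(\<epsilon> - \<eta>) * ln 5\<close>, the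
    \<open>+ 1\<close> ensuring strictness.\<close>
  define t where "t = (\<epsilon> - \<eta>) * ln 5 / (\<alpha> * D + 1)"
  have den: "\<alpha> * D + 1 > 0" using \<alpha> D by (intro add_nonneg_pos mult_nonneg_nonneg) auto
  have t: "t > 0" using den \<eta> by (simp add: t_def)
  define \<theta> where "\<theta> = exp (- t)"
  have \<theta>: "0 < \<theta>" "\<theta> < 1" using t by (auto simp: \<theta>_def)
  define G :: "(real ^ 'n \<Rightarrow> real ^ 'n) set" where "G = gens UNIV"
  interpret scaled_isometries \<theta> G
    by unfold_locales (auto simp: \<theta> G_def gens_norm gens_scaleR)
  obtain h where h: "bij_betw h {0..<card G} G" using ex_bij_betw_nat_finite finite_G by blast
  define I where "I = {0..<card G}"
  define S where "S = (\<lambda>i x. \<theta> *\<^sub>R h i x)"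
  have hI: "h ` I = G" using h by (simp add: bij_betw_def I_def)
  have SI: "(\<lambda>i. S i) ` I = (\<lambda>g x. \<theta> *\<^sub>R g x) ` G" unfolding hI[symmetric] image_image S_def ..
  have att: "attractor I S = {0}"
    unfolding attractor_def using inhom_attractor_eq[OF _ SI, of "{}"] by (simp add: levels_def)
  have sim: "contracting_similarity (S i)" if "i \<in> I" for i
  proof -
    have "h i \<in> gens UNIV" using that hI by (auto simp: G_def)
    then have "dist (S i x) (S i y) = \<theta> * dist x y" for x y
      using \<theta> gens_dist[of "h i" UNIV x y] by (simp add: S_def dist_norm flip: scaleR_diff_right)
    then show ?thesis unfolding contracting_similarity_def using \<theta> by blast
  qed
  \<comment> \<open>As the attractor is \<open>{0}\<close>, the singletons to be considered are
    those with \<open>c \<noteq> 0\<close>, whose orbits lie on a sphere of positive radius.\<close>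
  have dim: "ereal (D - \<epsilon>) \<le> lower_box_dim (inhom_attractor I S {c})" if c: "c \<noteq> 0" for c
  proof -
    define E where "E = inhom_attractor I S {c}"
    have E: "E = levels \<theta> G {c}" unfolding E_def by (rule inhom_attractor_eq[OF _ SI]) simp
    have bE: "bounded E" unfolding E by (intro compact_imp_bounded compact_levels) simp
    \<comment> \<open>The power of \<open>\<theta>\<close> accounts for the part
      \<open>j - 2\<close> of the word length \<open>(3 * m + 1) * (j - 2)\<close> that does not
      depend on \<open>m\<close>.\<close>
    define K where "K = \<kappa> * norm c * \<theta> ^ (j - 2)"
    have K: "K > 0" using \<kappa> c \<theta> by (simp add: K_def)
    show ?thesis unfolding E_def[symmetric]
    proof (rule lower_box_dim_geI[OF bE K _ c0])
      show "0 < ln 5 + \<alpha> * t" using \<alpha> t by (intro add_pos_nonneg) auto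
      show "0 < (D - \<eta>) * ln 5" using D \<eta> by simp
      have "(D - \<epsilon>) * (\<alpha> * t) \<le> D * (\<alpha> * t)"
        using assms(2) \<alpha> t by (intro mult_right_mono) auto
      also have "\<dots> = (\<epsilon> - \<eta>) * ln 5 * (\<alpha> * D / (\<alpha> * D + 1))" by (simp add: t_def)
      also have "\<dots> < (\<epsilon> - \<eta>) * ln 5 * 1"
        using den \<eta> by (intro mult_strict_left_mono) (auto simp: field_simps)
      finally show "(D - \<epsilon>) * (ln 5 + \<alpha> * t) < (D - \<eta>) * ln 5" by (simp add: algebra_simps)
    next
      fix m \<delta> assume \<delta>: "0 < \<delta>" "\<delta> * exp (real m * (ln 5 + \<alpha> * t)) \<le> K"
      define L where "L = (3 * m + 1) * (j - 2)"
      \<comment> \<open>Level \<open>L\<close> of the attractor is the orbit scaled by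
        \<open>\<theta> ^ L\<close>, so mesh \<open>\<delta>\<close> there is mesh
        \<open>\<rho>\<close> on the orbit itself.\<close>
      define \<rho> where "\<rho> = \<delta> / \<theta> ^ L"
      have \<rho>: "\<rho> > 0" using \<delta> \<theta> by (simp add: \<rho>_def)
      have \<theta>L: "\<theta> ^ L = \<theta> ^ (j - 2) * exp (- (real m * (\<alpha> * t)))"
      proof -
        have "\<theta> ^ L = \<theta> ^ (j - 2) * \<theta> ^ (3 * m * (j - 2))" by (simp add: L_def power_add)
        also have "\<theta> ^ (3 * m * (j - 2)) = exp (- (real m * (\<alpha> * t)))"
          unfolding \<theta>_def \<alpha>_def by (simp add: mult_ac flip: exp_of_nat_mult)
        finally show ?thesis .
      qed
      have e5: "exp (real m * (ln 5 + \<alpha> * t)) = 5 ^ m * exp (real m * (\<alpha> * t))"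
        by (simp add: distrib_left exp_add exp_of_nat_mult)
      have "\<rho> * 5 ^ m = \<delta> * exp (real m * (ln 5 + \<alpha> * t)) / \<theta> ^ (j - 2)"
        unfolding \<rho>_def \<theta>L e5 exp_minus by (simp add: field_simps)
      also have "\<dots> \<le> K / \<theta> ^ (j - 2)" using \<delta>(2) \<theta> by (intro divide_right_mono) auto
      also have "\<dots> = \<kappa> * L2_set (($) c) UNIV"
        using \<theta> by (simp add: K_def norm_vec_def L2_set_def)
      finally have "c0 * 5 powr (real m * (D - \<eta>)) \<le> real (card (cell \<rho> ` orb G L c))"
        unfolding L_def D_def G_def by (intro orbc \<rho>) (auto simp: j_def)
      also have "card (cell \<rho> ` orb G L c) \<le> card (cell \<delta> ` E)"
      proof (rule card_mono[OF finite_cells[OF bE \<delta>(1)]])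
        show "cell \<rho> ` orb G L c \<subseteq> cell \<delta> ` E"
        proof (rule image_subsetI)
          fix y assume "y \<in> orb G L c"
          then have "\<theta> ^ L *\<^sub>R y \<in> E" unfolding E levels_def by blast
          moreover have "cell \<rho> y = cell \<delta> (\<theta> ^ L *\<^sub>R y)"
            using \<theta> by (simp add: cell_def \<rho>_def mult.commute)
          ultimately show "cell \<rho> y \<in> cell \<delta> ` E" by blast
        qed
      qed
      also have "card (cell \<delta> ` E) = mesh_count \<delta> E" by (rule mesh_count_eq[OF \<delta>(1), symmetric])
      finally show "c0 * exp (real m * ((D - \<eta>) * ln 5)) \<le> real (mesh_count \<delta> E)"
        by (simp add: powr_def mult_ac)
    qed
  qed
  have "finite I" "I \<noteq> {}" using hI id_G by (auto simp: I_def)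
  then show ?thesis
    using sim att dim unfolding D_def j_def
    by (intro exI[of _ I] exI[of _ S]) auto
qed

end
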